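(* Let $0<\alpha<Q$, $1\le p<Q/\alpha$ and $1-(\alpha p)/Q\le\kappa<1$. Define $\beta$ by $\beta/Q=\alpha/Q-(1-\kappa)/p$ and assume $\beta<\delta$, where $\delta\in(0,1]$ is the regularity exponent of the kernel of $I_\alpha$ described in the context. Then the fractional integral operator $I_\alpha=(-\Delta_{\mathbb H^n})^{-\alpha/2}$ is bounded from $L^{p,\kappa}(\mathbb H^n)$ into $\mathcal C^\beta(\mathbb H^n)$.
   Context: The Heisenberg group $\mathbb H^n$ is $\mathbb C^n\times\mathbb R$ with multiplication $(z,t)\cdot(z',t')=(z+z',t+t'+2\,\mathrm{Im}(z\cdot\overline{z'}))$, $z\cdot\overline{z'}=\sum_j z_j\overline{z_j'}$; inverse $(z,t)^{-1}=(-z,-t)$; Haar measure is Lebesgue measure, $|E|$ the measure. Homogeneous norm $|(z,t)|=(|z|^4+t^2)^{1/4}$, balls $B(u,r)=\{v:|u^{-1}v|<r\}$, $Q=2n+2$. With $z_j=x_j+iy_j$, $X_j=\partial_{x_j}+2y_j\partial_t$, $Y_j=\partial_{y_j}-2x_j\partial_t$, $\Delta_{\mathbb H^n}=\sum_j(X_j^2+Y_j^2)$. $I_\alpha f=(-\Delta_{\mathbb H^n})^{-\alpha/2}f=\frac1{\Gamma(\alpha/2)}\int_0^\infty e^{s\Delta_{\mathbb H^n}}f\,s^{\alpha/2-1}ds=\int K^*_\alpha(u,v)f(v)\,dv$. The exponent $\delta$: a fixed $\delta\in(0,1]$ such that there is $C>0$ with $|K^*_\alpha(u,w)-K^*_\alpha(v,w)|\le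 C|v^{-1}u|^\delta/|w^{-1}u|^{Q-\alpha+\delta}$ for all $u,v,w$ with $|v^{-1}u|\le|w^{-1}u|/2$. $L^{p,\kappa}(\mathbb H^n)$ is the set of $f\in L^p_{\rm loc}$ with $\|f\|_{L^{p,\kappa}}:=\sup_B\big(|B|^{-\kappa}\int_B|f|^p\big)^{1/p}<\infty$ (supremum over all balls). $\mathcal C^\beta(\mathbb H^n)$ is the set of locally integrable $f$ with $\|f\|_{\mathcal C^\beta}:=\sup_B|B|^{-1-\beta/Q}\int_B|f-f_B|<\infty$, $f_B=|B|^{-1}\int_Bf$.
   Formalization: The bound is stated for those (real-valued) f in L^{p,κ} for which the integral defining I_α f converges absolutely for almost every u; for others, such as f(v)=|v|^{-Q(1-κ)/p}, that integral is infinite everywhere, so I_α f is undefined. *)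

theory Defs
  imports "HOL-Analysis.Analysis"
begin

type_synonym 'n heis = "(complex ^ 'n) \<times> real"

definition heis_mult :: "'n::finite heis \<Rightarrow> 'n heis \<Rightarrow> 'n heis" where
  "heis_mult u v = (fst u + fst v,
      snd u + snd v + 2 * Im (\<Sum>j\<in>UNIV. (fst u $ j) * cnj (fst v $ j)))"

definition heis_inv :: "'n::finite heis \<Rightarrow> 'n heis" where
  "heis_inv u = (- fst u, - snd u)"

definition heis_norm :: "'n::finite heis \<Rightarrow> real" where
  "heis_norm u = root 4 (norm (fst u) ^ 4 + (snd u)\<^sup>2)"

definition heis_ball :: "'n::finite heis \<Rightarrow> real \<Rightarrow> 'n heis set" where
  "heis_ball u r = {v. heis_norm (heis_mult (heis_inv u) v) < r}"

definition hdim :: "'n::finite itself \<Rightarrow> real" where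
  "hdim _ = 2 * real CARD('n) + 2"

text \<open>Horizontal directions: (e_j,0) generates X_j and (i e_j,0) generates Y_j;
  r \<mapsto> u\<cdot>(r e_j,0) is the integral curve of X_j through u, so X_j^2 f(u) is the
  second derivative of r \<mapsto> f(u\<cdot>(r e_j,0)) at 0 (similarly for Y_j).\<close>
definition hdir :: "'n::finite \<Rightarrow> bool \<Rightarrow> 'n heis" where
  "hdir j b = ((\<chi> k. if k = j then (if b then \<i> else 1) else 0), 0)"

definition hcurve :: "('n::finite heis \<Rightarrow> real) \<Rightarrow> 'n heis \<Rightarrow> 'n heis \<Rightarrow> real \<Rightarrow> real" where
  "hcurve f u d = (\<lambda>r. f (heis_mult u (r *\<^sub>R d)))"

definition sublap :: "('n::finite heis \<Rightarrow> real) \<Rightarrow> 'n heis \<Rightarrow> real" where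
  "sublap f u = (\<Sum>j\<in>UNIV. \<Sum>b\<in>UNIV. deriv (deriv (hcurve f u (hdir j b))) 0)"

text \<open>h is the heat kernel of the sub-Laplacian: e^{s Delta} f (u) = \<integral> f(v) h s (v^{-1} u) dv.
  It is the (nonnegative, normalised) classical fundamental solution of the heat equation
  d/ds h = Delta h with initial datum the Dirac mass at the identity (0,0).\<close>
definition heat_kernel :: "(real \<Rightarrow> 'n::finite heis \<Rightarrow> real) \<Rightarrow> bool" where
  "heat_kernel h \<longleftrightarrow>
     (\<forall>s>0. \<forall>u. 0 \<le> h s u) \<and>
     continuous_on ({0<..} \<times> UNIV) (\<lambda>(s,u). h s u) \<and>
     (\<forall>s>0. integrable lborel (h s) \<and> (\<integral>v. h s v \<partial>lborel) = 1) \<and>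
     (\<forall>s>0. \<forall>u. \<forall>j b. (\<forall>r. hcurve (h s) u (hdir j b) field_differentiable (at r)) \<and>
                      deriv (hcurve (h s) u (hdir j b)) field_differentiable (at 0)) \<and>
     (\<forall>s>0. \<forall>u. (\<lambda>r. h r u) field_differentiable (at s)) \<and>
     (\<forall>s>0. \<forall>u. deriv (\<lambda>r. h r u) s = sublap (h s) u) \<and>
     continuous_on ({0<..} \<times> UNIV) (\<lambda>(s,u). sublap (h s) u) \<and>
     (\<forall>\<phi>. continuous_on UNIV \<phi> \<and> bounded (range \<phi>) \<longrightarrow>
        ((\<lambda>s. \<integral>v. h s v * \<phi> v \<partial>lborel) \<longlongrightarrow> \<phi> 0) (at_right 0))"

text \<open>Kernel of I_alpha = (1/Gamma(alpha/2)) \<integral>_0^\<infinity> e^{s Delta} s^{alpha/2-1} ds: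
  K*_alpha(u,v) = K_alpha(v^{-1} u).\<close>
definition frac_kernel :: "(real \<Rightarrow> 'n::finite heis \<Rightarrow> real) \<Rightarrow> real \<Rightarrow> 'n heis \<Rightarrow> real" where
  "frac_kernel h \<alpha> u = (1 / Gamma (\<alpha> / 2)) * (LINT s:{0<..}|lborel. h s u * s powr (\<alpha> / 2 - 1))"

definition frac_kernel2 :: "(real \<Rightarrow> 'n::finite heis \<Rightarrow> real) \<Rightarrow> real \<Rightarrow> 'n heis \<Rightarrow> 'n heis \<Rightarrow> real" where
  "frac_kernel2 h \<alpha> u v = frac_kernel h \<alpha> (heis_mult (heis_inv v) u)"

definition frac_int :: "(real \<Rightarrow> 'n::finite heis \<Rightarrow> real) \<Rightarrow> real \<Rightarrow> ('n heis \<Rightarrow> real) \<Rightarrow> 'n heis \<Rightarrow> real" where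
  "frac_int h \<alpha> f u = (\<integral>v. frac_kernel2 h \<alpha> u v * f v \<partial>lebesgue)"

definition kernel_regular :: "(real \<Rightarrow> 'n::finite heis \<Rightarrow> real) \<Rightarrow> real \<Rightarrow> real \<Rightarrow> bool" where
  "kernel_regular h \<alpha> \<delta> \<longleftrightarrow> (\<exists>C>0. \<forall>u v w.
     heis_norm (heis_mult (heis_inv v) u) \<le> heis_norm (heis_mult (heis_inv w) u) / 2 \<longrightarrow>
     \<bar>frac_kernel2 h \<alpha> u w - frac_kernel2 h \<alpha> v w\<bar>
       \<le> C * heis_norm (heis_mult (heis_inv v) u) powr \<delta>
           / heis_norm (heis_mult (heis_inv w) u) powr (hdim TYPE('n) - \<alpha> + \<delta>))"

definition morrey_vals :: "real \<Rightarrow> real \<Rightarrow> ('n::finite heis \<Rightarrow> real) \<Rightarrow> real set" where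
  "morrey_vals p \<kappa> f = {measure lebesgue (heis_ball u r) powr (- \<kappa>) *
        (LINT v:heis_ball u r|lebesgue. \<bar>f v\<bar> powr p) | u r. r > 0}"

definition in_morrey :: "real \<Rightarrow> real \<Rightarrow> ('n::finite heis \<Rightarrow> real) \<Rightarrow> bool" where
  "in_morrey p \<kappa> f \<longleftrightarrow> f \<in> borel_measurable lebesgue \<and>
     (\<forall>u r. r > 0 \<longrightarrow> set_integrable lebesgue (heis_ball u r) (\<lambda>v. \<bar>f v\<bar> powr p)) \<and>
     bdd_above (morrey_vals p \<kappa> f)"

definition morrey_norm :: "real \<Rightarrow> real \<Rightarrow> ('n::finite heis \<Rightarrow> real) \<Rightarrow> real" where
  "morrey_norm p \<kappa> f = (Sup (morrey_vals p \<kappa> f)) powr (1 / p)"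

definition ball_avg :: "('n::finite heis \<Rightarrow> real) \<Rightarrow> 'n heis set \<Rightarrow> real" where
  "ball_avg f B = (LINT v:B|lebesgue. f v) / measure lebesgue B"

definition campanato_vals :: "real \<Rightarrow> ('n::finite heis \<Rightarrow> real) \<Rightarrow> real set" where
  "campanato_vals \<beta> f = {measure lebesgue (heis_ball u r) powr (- 1 - \<beta> / hdim TYPE('n)) *
        (LINT v:heis_ball u r|lebesgue. \<bar>f v - ball_avg f (heis_ball u r)\<bar>) | u r. r > 0}"

definition in_campanato :: "real \<Rightarrow> ('n::finite heis \<Rightarrow> real) \<Rightarrow> bool" where
  "in_campanato \<beta> f \<longleftrightarrow> f \<in> borel_measurable lebesgue \<and>
     (\<forall>u r. r > 0 \<longrightarrow> set_integrable lebesgue (heis_ball u r) f) \<and>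
     bdd_above (campanato_vals \<beta> f)"

definition campanato_norm :: "real \<Rightarrow> ('n::finite heis \<Rightarrow> real) \<Rightarrow> real" where
  "campanato_norm \<beta> f = Sup (campanato_vals \<beta> f)"

end

theory Submission
  imports Defs
begin

text \<open>Regularity alone forces the kernel \<open>K\<close> of \<open>I\<^sub>\<alpha>\<close> to have a limit \<open>c\<close> at infinity, with
  \<open>|K x - c| \<le> D |x|\<^bsup>\<alpha>-Q\<^esup>\<close>. The value of \<open>c\<close> is irrelevant, since it drops out of oscillations.
  Given a ball \<open>B\<close> of radius \<open>r\<close>, split \<open>f\<close> into its restrictions to the concentric ball of radius \<open>5 r\<close>
  and to the complement. The potential of the local part, less \<open>c\<close> times its integral, is integrated over \<open>B\<close>
  by Tonelli's theorem. The potential of the far part varies over \<open>B\<close> by at most a constant times \<open>r\<^bsup>\<beta>\<^esup>\<close>, by kernel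
  regularity and a dyadic decomposition that converges as \<open>\<beta> < \<delta>\<close>. The Morrey condition enters
  through \<open>\<integral>\<^sub>B |f| \<le> 2 \<parallel>f\<parallel> |B|\<^bsup>1-(1-\<kappa>)/p\<^esup>\<close>.\<close>

section \<open>The Heisenberg group\<close>

definition hform :: "complex ^ 'n \<Rightarrow> complex ^ 'n \<Rightarrow> complex" where
  "hform z w = (\<Sum>j\<in>UNIV. z $ j * cnj (w $ j))"

lemma hform_add_left: "hform (z + z') w = hform z w + hform z' w"
  by (simp add: hform_def distrib_right sum.distrib)

lemma hform_add_right: "hform z (w + w') = hform z w + hform z w'"
  by (simp add: hform_def distrib_left sum.distrib)

lemma hform_minus_left [simp]: "hform (- z) w = - hform z w"
  by (simp add: hform_def sum_negf)

lemma hform_minus_right [simp]: "hform z (- w) = - hform z w"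
  by (simp add: hform_def sum_negf)

lemma hform_zero [simp]: "hform 0 w = 0" "hform z 0 = 0"
  by (simp_all add: hform_def)

lemma hform_scaleR_left [simp]: "hform (r *\<^sub>R z) w = r *\<^sub>R hform z w"
  by (simp add: hform_def scaleR_sum_right)

lemma hform_scaleR_right [simp]: "hform z (r *\<^sub>R w) = r *\<^sub>R hform z w"
  by (simp add: hform_def scaleR_sum_right)

lemma hform_commute: "hform w z = cnj (hform z w)"
  by (simp add: hform_def mult.commute)

lemma hform_self: "hform z z = of_real ((norm z)\<^sup>2)"
proof -
  have "(norm z)\<^sup>2 = (\<Sum>j\<in>UNIV. (cmod (z $ j))\<^sup>2)"
    by (simp add: norm_vec_def L2_set_def sum_nonneg)
  then show ?thesis
    by (simp add: hform_def complex_norm_square[unfolded of_real_power])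
qed

lemma norm_hform_le: "cmod (hform z w) \<le> norm z * norm w"
proof -
  have "cmod (hform z w) \<le> (\<Sum>j\<in>UNIV. cmod (z $ j) * cmod (w $ j))"
    unfolding hform_def by (rule order_trans[OF norm_sum]) (simp add: norm_mult)
  also have "\<dots> \<le> norm z * norm w"
    unfolding norm_vec_def using L2_set_mult_ineq[of "\<lambda>j. cmod (z $ j)" "\<lambda>j. cmod (w $ j)" UNIV] by simp
  finally show ?thesis .
qed

lemma heis_mult_eq:
  "heis_mult u v = (fst u + fst v, snd u + snd v + 2 * Im (hform (fst u) (fst v)))"
  by (simp add: heis_mult_def hform_def)

lemma heis_mult_assoc: "heis_mult (heis_mult u v) w = heis_mult u (heis_mult v w)"
  by (simp add: heis_mult_eq hform_add_left hform_add_right algebra_simps)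

lemma heis_mult_zero [simp]: "heis_mult 0 u = u" "heis_mult u 0 = u"
  by (simp_all add: heis_mult_eq)

lemma heis_inv_zero [simp]: "heis_inv 0 = 0"
  by (simp add: heis_inv_def prod_eq_iff)

lemma heis_inv_inv [simp]: "heis_inv (heis_inv u) = u"
  by (simp add: heis_inv_def)

lemma heis_mult_inv [simp]: "heis_mult u (heis_inv u) = 0" "heis_mult (heis_inv u) u = 0"
  by (simp_all add: heis_mult_eq heis_inv_def hform_self prod_eq_iff)

lemma heis_mult_inv_cancel [simp]:
  "heis_mult u (heis_mult (heis_inv u) v) = v" "heis_mult (heis_inv u) (heis_mult u v) = v"
  by (simp_all flip: heis_mult_assoc)

lemma heis_inv_mult: "heis_inv (heis_mult u v) = heis_mult (heis_inv v) (heis_inv u)"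
  using hform_commute[of "fst v" "fst u"] by (simp add: heis_mult_eq heis_inv_def)

text \<open>The square of the norm is the modulus of the complex number |z|^2 + i t, so norm
  estimates on the group reduce to estimates of moduli in the complex plane.\<close>

lemma heis_norm_eq: "heis_norm u = sqrt (cmod (Complex ((norm (fst u))\<^sup>2) (snd u)))"
proof (rule power_eq_imp_eq_base)
  have "sqrt x ^ 4 = x\<^sup>2" if "0 \<le> x" for x :: real
    using that power_mult[of "sqrt x" 2 2] by simp
  then show "heis_norm u ^ 4 = sqrt (cmod (Complex ((norm (fst u))\<^sup>2) (snd u))) ^ 4"
    by (simp add: heis_norm_def complex_norm flip: power_mult)
qed (simp_all add: heis_norm_def)

lemma heis_norm_nonneg [simp]: "0 \<le> heis_norm u"
  by (simp add: heis_norm_def)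

lemma heis_norm_eq_0_iff [simp]: "heis_norm u = 0 \<longleftrightarrow> u = 0"
  by (auto simp: heis_norm_eq prod_eq_iff complex_eq_iff)

lemma heis_norm_zero [simp]: "heis_norm 0 = 0"
  by simp

lemma heis_norm_pos_iff [simp]: "0 < heis_norm u \<longleftrightarrow> u \<noteq> 0"
  using heis_norm_nonneg[of u] heis_norm_eq_0_iff[of u] by linarith

lemma heis_norm_inv [simp]: "heis_norm (heis_inv u) = heis_norm u"
  by (simp add: heis_norm_def heis_inv_def)

text \<open>Symmetry of the left-invariant distance between u and v: the two products are inverse to
  each other, and inversion preserves the norm.\<close>

lemma heis_norm_mult_inv_commute:
  "heis_norm (heis_mult (heis_inv u) v) = heis_norm (heis_mult (heis_inv v) u)"
  by (metis heis_inv_inv heis_inv_mult heis_norm_inv)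

lemma norm_fst_le_heis_norm: "norm (fst u) \<le> heis_norm u"
proof -
  have "(norm (fst u))\<^sup>2 \<le> cmod (Complex ((norm (fst u))\<^sup>2) (snd u))"
    using complex_Re_le_cmod[of "Complex ((norm (fst u))\<^sup>2) (snd u)"] by simp
  then show ?thesis
    unfolding heis_norm_eq by (intro real_le_rsqrt) auto
qed

lemma abs_snd_le_heis_norm: "\<bar>snd u\<bar> \<le> (heis_norm u)\<^sup>2"
  using abs_Im_le_cmod[of "Complex ((norm (fst u))\<^sup>2) (snd u)"] by (simp add: heis_norm_eq)

text \<open>The real and imaginary parts of the twisted product combine to a single Hermitian form:
  writing \<open>A u = |z|\<^sup>2 + \<i> t\<close>, one has \<open>A (u v) = A u + A v + 2 \<langle>z, z'\<rangle>\<close>, and \<open>|A u| = |u|\<^sup>2\<close>.\<close>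
lemma heis_norm_mult_le: "heis_norm (heis_mult u v) \<le> heis_norm u + heis_norm v"
proof -
  define A where "A u = Complex ((norm (fst u))\<^sup>2) (snd u)" for u :: "'a heis"
  have N: "heis_norm u = sqrt (cmod (A u))" for u :: "'a heis"
    by (simp add: heis_norm_eq A_def)
  have "complex_of_real ((norm (fst u + fst v))\<^sup>2)
      = of_real ((norm (fst u))\<^sup>2) + of_real ((norm (fst v))\<^sup>2) + (hform (fst u) (fst v) + cnj (hform (fst u) (fst v)))"
    unfolding hform_self[symmetric] using hform_commute[of "fst v" "fst u"]
    by (simp add: hform_add_left hform_add_right)
  then have "Re (complex_of_real ((norm (fst u + fst v))\<^sup>2)) =
      (norm (fst u))\<^sup>2 + (norm (fst v))\<^sup>2 + 2 * Re (hform (fst u) (fst v))"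
    by simp
  then have "A (heis_mult u v) = A u + A v + 2 * hform (fst u) (fst v)"
    by (simp add: A_def heis_mult_eq complex_eq_iff)
  then have "cmod (A (heis_mult u v)) \<le> cmod (A u) + cmod (A v) + 2 * cmod (hform (fst u) (fst v))"
    using norm_triangle_ineq[of "A u + A v" "2 * hform (fst u) (fst v)"] norm_triangle_ineq[of "A u" "A v"]
    by (simp add: norm_mult)
  also have "cmod (hform (fst u) (fst v)) \<le> heis_norm u * heis_norm v"
    by (rule order_trans[OF norm_hform_le]) (intro mult_mono norm_fst_le_heis_norm; simp)
  also have "cmod (A u) + cmod (A v) + 2 * (heis_norm u * heis_norm v) = (heis_norm u + heis_norm v)\<^sup>2"
    by (simp add: N power2_sum)
  finally have "cmod (A (heis_mult u v)) \<le> (heis_norm u + heis_norm v)\<^sup>2"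
    by simp
  then show ?thesis
    unfolding N[of "heis_mult u v"] by (intro real_le_lsqrt) auto
qed

lemma heis_dist_triangle:
  "heis_norm (heis_mult (heis_inv u) w)
    \<le> heis_norm (heis_mult (heis_inv u) v) + heis_norm (heis_mult (heis_inv v) w)"
  using heis_norm_mult_le[of "heis_mult (heis_inv u) v" "heis_mult (heis_inv v) w"]
  by (simp add: heis_mult_assoc)

lemma continuous_on_hform [continuous_intros]:
  "continuous_on S f \<Longrightarrow> continuous_on S g \<Longrightarrow> continuous_on S (\<lambda>x. hform (f x) (g x))"
  unfolding hform_def by (intro continuous_intros)

lemma continuous_on_heis_mult [continuous_intros]:
  "continuous_on S f \<Longrightarrow> continuous_on S g \<Longrightarrow> continuous_on S (\<lambda>x. heis_mult (f x) (g x))"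
  unfolding heis_mult_eq by (intro continuous_intros)

lemma continuous_on_heis_inv [continuous_intros]:
  "continuous_on S f \<Longrightarrow> continuous_on S (\<lambda>x. heis_inv (f x))"
  unfolding heis_inv_def by (intro continuous_intros)

lemma continuous_on_heis_norm [continuous_intros]:
  "continuous_on S f \<Longrightarrow> continuous_on S (\<lambda>x. heis_norm (f x))"
  unfolding heis_norm_def by (intro continuous_intros)

text \<open>The anisotropic dilations. The weight 2 on the centre matches the real-bilinear term of
  the group law, which makes them group homomorphisms, and it makes the norm homogeneous of degree
  1.\<close>

definition heis_dil :: "real \<Rightarrow> 'n::finite heis \<Rightarrow> 'n heis" where
  "heis_dil r u = (r *\<^sub>R fst u, r\<^sup>2 * snd u)"

lemma heis_norm_dil: "0 \<le> r \<Longrightarrow> heis_norm (heis_dil r u) = r * heis_norm u"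
proof -
  assume "0 \<le> r"
  have "Complex ((norm (fst (heis_dil r u)))\<^sup>2) (snd (heis_dil r u))
      = of_real (r\<^sup>2) * Complex ((norm (fst u))\<^sup>2) (snd u)"
    by (simp add: heis_dil_def complex_eq_iff power_mult_distrib)
  then show ?thesis
    using \<open>0 \<le> r\<close> by (simp add: heis_norm_eq norm_mult real_sqrt_mult del: of_real_power)
qed

lemma heis_dil_mult: "heis_mult (heis_dil r u) (heis_dil r v) = heis_dil r (heis_mult u v)"
  by (simp add: heis_mult_eq heis_dil_def algebra_simps power2_eq_square)

lemma heis_dil_inv: "heis_inv (heis_dil r u) = heis_dil r (heis_inv u)"
  by (simp add: heis_inv_def heis_dil_def)

lemma heis_dil_dil: "heis_dil r (heis_dil s u) = heis_dil (r * s) u"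
  by (simp add: heis_dil_def power_mult_distrib)

section \<open>Haar measure\<close>

lemma heis_mult_measurable [measurable (raw)]:
  "f \<in> borel_measurable M \<Longrightarrow> g \<in> borel_measurable M \<Longrightarrow> (\<lambda>x. heis_mult (f x) (g x)) \<in> borel_measurable M"
  using borel_measurable_continuous_Pair[of f M g "heis_mult"]
    continuous_on_heis_mult[OF continuous_on_fst[OF continuous_on_id] continuous_on_snd[OF continuous_on_id], of UNIV]
  by (simp add: split_def id_def)

lemma heis_inv_measurable [measurable]: "heis_inv \<in> borel_measurable borel"
  by (intro borel_measurable_continuous_onI continuous_intros)

lemma heis_norm_measurable [measurable]: "heis_norm \<in> borel_measurable borel"
  by (intro borel_measurable_continuous_onI continuous_intros)

lemma heis_dil_measurable [measurable]: "heis_dil r \<in> borel_measurable borel"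
  unfolding heis_dil_def[abs_def] by (intro borel_measurable_continuous_onI continuous_intros)

text \<open>Splits off the centre, so that translations and dilations can be treated first on each
  central line and then on the base.\<close>

lemma nn_integral_heis_fubini:
  fixes g :: "'n::finite heis \<Rightarrow> ennreal"
  assumes [measurable]: "g \<in> borel_measurable borel"
  shows "(\<integral>\<^sup>+v. g v \<partial>lborel) = (\<integral>\<^sup>+z. (\<integral>\<^sup>+t. g (z, t) \<partial>lborel) \<partial>lborel)"
  by (subst lborel.nn_integral_fst) (auto simp: lborel_prod)

text \<open>A left translation acts on each vertical line as an ordinary translation.\<close>
lemma nn_integral_heis_mult:
  fixes f :: "'n::finite heis \<Rightarrow> ennreal"
  assumes [measurable]: "f \<in> borel_measurable borel"
  shows "(\<integral>\<^sup>+v. f (heis_mult u v) \<partial>lborel) = (\<integral>\<^sup>+v. f v \<partial>lborel)"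
proof -
  have shift: "(\<integral>\<^sup>+x. g (a + x) \<partial>lborel) = (\<integral>\<^sup>+x. g x \<partial>lborel)"
    if [measurable]: "g \<in> borel_measurable borel" for g :: "'b::euclidean_space \<Rightarrow> ennreal" and a
    by (subst lborel_distr_plus[symmetric, of a]) (subst nn_integral_distr; simp)
  have "(\<integral>\<^sup>+v. f (heis_mult u v) \<partial>lborel)
      = (\<integral>\<^sup>+z. (\<integral>\<^sup>+t. f (fst u + z, (snd u + 2 * Im (hform (fst u) z)) + t) \<partial>lborel) \<partial>lborel)"
    by (subst nn_integral_heis_fubini, measurable) (simp add: heis_mult_eq algebra_simps)
  also have "\<dots> = (\<integral>\<^sup>+z. (\<integral>\<^sup>+t. f (fst u + z, t) \<partial>lborel) \<partial>lborel)"
    by (intro nn_integral_cong shift[of "\<lambda>t. f (fst u + _, t)"]) measurable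
  \<comment> \<open>Once the shear along the centre has been integrated out, only a Euclidean
    translation of the base variable remains.\<close>
  also have "\<dots> = (\<integral>\<^sup>+z. (\<integral>\<^sup>+t. f (z, t) \<partial>lborel) \<partial>lborel)"
    by (rule shift[of "\<lambda>z. \<integral>\<^sup>+t. f (z, t) \<partial>lborel"]) measurable
  also have "\<dots> = (\<integral>\<^sup>+v. f v \<partial>lborel)"
    by (simp add: nn_integral_heis_fubini)
  finally show ?thesis .
qed

lemma hdim_eq: "hdim TYPE('n::finite) = real (DIM(complex ^ 'n) + 2)"
  by (simp add: hdim_def)

text \<open>The Jacobian is r^(2n) from the base times r^2 from the centre; this is where Q = 2n + 2
  comes from.\<close>

lemma nn_integral_heis_dil:
  fixes f :: "'n::finite heis \<Rightarrow> ennreal"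
  assumes [measurable]: "f \<in> borel_measurable borel" and r: "0 < r"
  shows "(\<integral>\<^sup>+v. f v \<partial>lborel) = ennreal (r powr hdim TYPE('n)) * (\<integral>\<^sup>+v. f (heis_dil r v) \<partial>lborel)"
proof -
  have scale: "(\<integral>\<^sup>+x. g x \<partial>lborel) = ennreal (c ^ DIM('b)) * (\<integral>\<^sup>+x. g (c *\<^sub>R x) \<partial>lborel)"
    if [measurable]: "g \<in> borel_measurable borel" and c: "0 < c" for g :: "'b::euclidean_space \<Rightarrow> ennreal" and c
    using c by (subst lborel_affine[of c 0]) (simp_all add: nn_integral_density nn_integral_distr nn_integral_cmult)
  have "(\<integral>\<^sup>+v. f v \<partial>lborel) = (\<integral>\<^sup>+z. ennreal (r\<^sup>2) * (\<integral>\<^sup>+t. f (z, r\<^sup>2 * t) \<partial>lborel) \<partial>lborel)"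
    using r by (subst nn_integral_heis_fubini, simp) (intro nn_integral_cong, subst scale[of _ "r\<^sup>2"], simp_all)
  also have "\<dots> = ennreal (r\<^sup>2) * (\<integral>\<^sup>+z. (\<integral>\<^sup>+t. f (z, r\<^sup>2 * t) \<partial>lborel) \<partial>lborel)"
    by (intro nn_integral_cmult) measurable
  also have "\<dots> = ennreal (r\<^sup>2) * (ennreal (r ^ DIM(complex ^ 'n)) * (\<integral>\<^sup>+z. (\<integral>\<^sup>+t. f (r *\<^sub>R z, r\<^sup>2 * t) \<partial>lborel) \<partial>lborel))"
    using r by (subst scale[of "\<lambda>z. \<integral>\<^sup>+t. f (z, r\<^sup>2 * t) \<partial>lborel" r]) simp_all
  also have "\<dots> = ennreal (r ^ (DIM(complex ^ 'n) + 2)) * (\<integral>\<^sup>+v. f (heis_dil r v) \<partial>lborel)"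
  proof -
    have "ennreal (r ^ (DIM(complex ^ 'n) + 2)) = ennreal (r\<^sup>2) * ennreal (r ^ DIM(complex ^ 'n))"
      unfolding power_add using r by (subst ennreal_mult[symmetric]) (simp_all add: mult.commute)
    moreover have "(\<integral>\<^sup>+v. f (heis_dil r v) \<partial>lborel) = (\<integral>\<^sup>+z. (\<integral>\<^sup>+t. f (r *\<^sub>R z, r\<^sup>2 * t) \<partial>lborel) \<partial>lborel)"
      by (subst nn_integral_heis_fubini, measurable) (simp add: heis_dil_def)
    ultimately show ?thesis by (simp add: mult.assoc)
  qed
  also have "r ^ (DIM(complex ^ 'n) + 2) = r powr hdim TYPE('n)"
    unfolding hdim_eq using r by (subst powr_realpow) auto
  finally show ?thesis .
qed

section \<open>Volumes of Heisenberg balls\<close>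

lemma heis_ball_iff: "v \<in> heis_ball u r \<longleftrightarrow> heis_norm (heis_mult (heis_inv u) v) < r"
  by (simp add: heis_ball_def)

lemma heis_ball_measurable [measurable]: "heis_ball u r \<in> sets borel"
  unfolding heis_ball_def by measurable

lemma open_heis_ball: "open (heis_ball u r)"
  unfolding heis_ball_def by (intro open_Collect_less continuous_intros)

lemma heis_ball_self: "0 < r \<Longrightarrow> u \<in> heis_ball u r"
  by (simp add: heis_ball_iff)

lemma bounded_heis_ball_zero: "bounded (heis_ball (0 :: 'n::finite heis) r)"
proof -
  have "norm v \<le> r + r\<^sup>2" if "v \<in> heis_ball 0 r" for v :: "'n heis"
  proof -
    have v: "heis_norm v \<le> r" using that by (simp add: heis_ball_iff)
    have "norm v \<le> norm (fst v) + norm (snd v)"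
      using norm_Pair_le[of "fst v" "snd v"] by simp
    also have "\<dots> \<le> r + r\<^sup>2"
      using norm_fst_le_heis_norm[of v] abs_snd_le_heis_norm[of v] power_mono[OF v, of 2] v by simp
    finally show ?thesis .
  qed
  then show ?thesis unfolding bounded_iff by blast
qed

definition ball_volume :: "'n::finite itself \<Rightarrow> real" where
  "ball_volume _ = measure lborel (heis_ball (0 :: 'n heis) 1)"

text \<open>A nonempty open set is not negligible. Finiteness has to be checked as well, because
  \<open>measure\<close> returns 0 on sets of infinite measure.\<close>

lemma ball_volume_pos: "0 < ball_volume TYPE('n::finite)"
proof -
  have fin: "emeasure lborel (heis_ball (0 :: 'n heis) 1) < \<infinity>"
    by (rule emeasure_bounded_finite[OF bounded_heis_ball_zero])
  have "heis_ball (0 :: 'n heis) 1 \<noteq> {}"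
    using heis_ball_self[of 1 0] by auto
  then have "\<not> negligible (heis_ball (0 :: 'n heis) 1)"
    using open_not_negligible[OF open_heis_ball] by blast
  then have "emeasure lborel (heis_ball (0 :: 'n heis) 1) \<noteq> 0"
    by (auto simp: negligible_iff_null_sets null_sets_def emeasure_completion)
  then show ?thesis
    unfolding ball_volume_def measure_def using fin by (simp add: enn2real_positive_iff zero_less_iff_neq_zero)
qed

text \<open>A left translation moves the centre to the origin, and a dilation then brings the radius
  to 1.\<close>

lemma emeasure_heis_ball:
  fixes u :: "'n::finite heis"
  assumes r: "0 < r"
  shows "emeasure lborel (heis_ball u r) = ennreal (ball_volume TYPE('n) * r powr hdim TYPE('n))"
proof -
  have "emeasure lborel (heis_ball u r) = (\<integral>\<^sup>+v. indicator (heis_ball u r) v \<partial>lborel)"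
    by (simp add: nn_integral_indicator)
  also have "\<dots> = (\<integral>\<^sup>+v. indicator (heis_ball u r) (heis_mult u v) \<partial>lborel)"
    by (subst nn_integral_heis_mult) simp_all
  also have "\<dots> = ennreal (r powr hdim TYPE('n)) *
      (\<integral>\<^sup>+v. indicator (heis_ball u r) (heis_mult u (heis_dil r v)) \<partial>lborel)"
    using r by (subst nn_integral_heis_dil[of _ r]) simp_all
  also have "(\<lambda>v. indicator (heis_ball u r) (heis_mult u (heis_dil r v)) :: ennreal)
      = indicator (heis_ball 0 1)"
    using r by (auto simp: indicator_def heis_ball_iff heis_norm_dil fun_eq_iff mult_less_cancel_left1)
  also have "(\<integral>\<^sup>+v. indicator (heis_ball (0 :: 'n heis) 1) v \<partial>lborel) = ennreal (ball_volume TYPE('n))"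
    using emeasure_bounded_finite[OF bounded_heis_ball_zero[where 'n='n], of 1]
    by (simp add: nn_integral_indicator ball_volume_def emeasure_eq_ennreal_measure)
  finally show ?thesis
    by (simp add: ennreal_mult' mult.commute ball_volume_def)
qed

lemma measure_heis_ball:
  fixes u :: "'n::finite heis"
  assumes r: "0 < r"
  shows "measure lebesgue (heis_ball u r) = ball_volume TYPE('n) * r powr hdim TYPE('n)"
  using emeasure_heis_ball[OF r, of u] ball_volume_pos[where 'n='n]
  by (simp add: measure_def emeasure_completion)

section \<open>Regular kernels\<close>

text \<open>The regularity condition for a convolution kernel K, that is, for K*(u,v) = K(v^{-1} u),
  with the base point w placed at the origin. The number \<open>a\<close> stands for Q - \<alpha>.
  The size of K is controlled later, in \<open>limit_at_infinity\<close>, from this condition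
  alone.\<close>

locale regular_kernel =
  fixes K :: "'n::finite heis \<Rightarrow> real" and C a \<delta> :: real
  assumes C: "0 < C" and a: "0 < a" and \<delta>: "0 < \<delta>"
    and regular: "\<And>x y. heis_norm (heis_mult (heis_inv y) x) \<le> heis_norm x / 2 \<Longrightarrow>
      \<bar>K x - K y\<bar> \<le> C * heis_norm (heis_mult (heis_inv y) x) powr \<delta> / heis_norm x powr (a + \<delta>)"
begin

lemma near_diff_le:
  assumes "heis_norm (heis_mult (heis_inv y) x) \<le> heis_norm x / 2"
  shows "\<bar>K x - K y\<bar> \<le> C * heis_norm x powr (- a)"
proof (cases "x = 0")
  case True
  \<comment> \<open>At the origin the conventions \<open>0 powr _ = 0\<close> and
    \<open>_ / 0 = 0\<close> turn both bounds into 0, so the regularity condition itself says that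
    the difference vanishes.\<close>
  then show ?thesis using regular[OF assms] C by simp
next
  case False
  have "\<bar>K x - K y\<bar> \<le> C * heis_norm (heis_mult (heis_inv y) x) powr \<delta> / heis_norm x powr (a + \<delta>)"
    by (rule regular[OF assms])
  also have "\<dots> \<le> C * heis_norm x powr \<delta> / heis_norm x powr (a + \<delta>)"
  proof (intro divide_right_mono mult_left_mono powr_mono2)
    show "heis_norm (heis_mult (heis_inv y) x) \<le> heis_norm x"
      using assms heis_norm_nonneg[of x] by linarith
  qed (use C \<delta> in auto)
  also have "\<dots> = C * heis_norm x powr (- a)"
    using False by (simp add: powr_add powr_minus divide_simps)
  finally show ?thesis .
qed

text \<open>For fixed x the regularity bound tends to 0 as y approaches x. The purpose is Borel
  measurability of K, where the single exceptional point 0 does no harm.\<close>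

lemma continuous_on_kernel: "continuous_on (- {0}) K"
proof -
  have "(K \<longlongrightarrow> K x) (at x)" if x: "x \<noteq> 0" for x
  proof -
    define d where "d y = heis_norm (heis_mult (heis_inv y) x)" for y
    have "continuous_on UNIV d"
      unfolding d_def by (intro continuous_intros)
    then have "(d \<longlongrightarrow> d x) (at x)"
      by (simp only: continuous_on_def) blast
    then have d: "(d \<longlongrightarrow> 0) (at x)"
      by (simp add: d_def)
    have ev: "eventually (\<lambda>y. d y < heis_norm x / 2) (at x)"
      using order_tendstoD(2)[OF d, of "heis_norm x / 2"] x by simp
    have "((\<lambda>y. C * d y powr \<delta> / heis_norm x powr (a + \<delta>)) \<longlongrightarrow> C * 0 powr \<delta> / heis_norm x powr (a + \<delta>)) (at x)"
      using \<delta> x by (intro tendsto_intros d) (auto simp: d_def)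
    then have "((\<lambda>y. C * d y powr \<delta> / heis_norm x powr (a + \<delta>)) \<longlongrightarrow> 0) (at x)"
      by simp
    then have "((\<lambda>y. K y - K x) \<longlongrightarrow> 0) (at x)"
    proof (rule Lim_null_comparison[rotated])
      show "eventually (\<lambda>y. norm (K y - K x) \<le> C * d y powr \<delta> / heis_norm x powr (a + \<delta>)) (at x)"
        using ev by eventually_elim (use regular[of _ x] in \<open>auto simp: d_def abs_minus_commute\<close>)
    qed
    then show ?thesis by (rule LIM_zero_cancel)
  qed
  then show ?thesis
    by (auto simp: continuous_on_def intro: tendsto_within_subset)
qed

lemma kernel_measurable [measurable]: "K \<in> borel_measurable borel"
  by (rule borel_measurable_continuous_countable_exceptions[of "{0}"]) (use continuous_on_kernel in auto)

text \<open>Along a ray \<open>heis_dil (q ^ k) x\<close> the kernel is Cauchy with geometric rate, and its limit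
  is locally constant in \<open>x\<close>, hence constant on the connected punctured group.\<close>
lemma limit_at_infinity:
  obtains c D where "0 < D" "\<And>x. x \<noteq> 0 \<Longrightarrow> \<bar>K x - c\<bar> \<le> D * heis_norm x powr (- a)"
proof -
  \<comment> \<open>A dilation factor so close to 1 that each point of a ray lies within half its
    norm of the next one: 1 - l = -1/10 and 1 - l^2 = -21/100, and both (1/10)^4 and (21/100)^2 are
    at most (1/2)^4.\<close>
  define l :: real where "l = 11 / 10"
  define q where "q = l powr (- a)"
  have q: "0 < q" "q < 1"
    using a unfolding q_def l_def by (auto simp: powr_less_one)
  define X where "X x k = heis_dil (l ^ k) x" for x :: "'n heis" and k :: nat
  have X_Suc: "X x (Suc k) = heis_dil l (X x k)" for x k
    by (simp add: X_def heis_dil_dil)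
  have norm_X: "heis_norm (X x k) = l ^ k * heis_norm x" for x k
    by (simp add: X_def heis_norm_dil l_def)
  have norm_X_powr: "heis_norm (X x k) powr (- a) = heis_norm x powr (- a) * q ^ k" for x k
  proof -
    have "(l ^ k) powr (- a) = q ^ k"
      by (simp add: q_def l_def powr_powr powr_realpow[symmetric] mult.commute)
    then show ?thesis
      by (simp add: norm_X powr_mult l_def mult.commute)
  qed
  have close: "heis_norm (heis_mult (heis_inv (heis_dil l y)) y) \<le> heis_norm y / 2" for y :: "'n heis"
  proof -
    \<comment> \<open>The twist of the group law vanishes here, since \<open>hform\<close> of a
      vector with itself is real.\<close>
    have eq: "heis_mult (heis_inv (heis_dil l y)) y = (- (1 / 10) *\<^sub>R fst y, - (21 / 100) * snd y)"
      by (simp add: heis_mult_eq heis_dil_def heis_inv_def l_def hform_self scaleR_left_diff_distrib[symmetric]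
          power2_eq_square prod_eq_iff vec_eq_iff complex_eq_iff)
    have "root 4 ((norm (fst y) / 10) ^ 4 + (21 * snd y / 100)\<^sup>2) \<le> root 4 ((1 / 2) ^ 4 * (norm (fst y) ^ 4 + (snd y)\<^sup>2))"
      by (rule real_root_le_mono) (auto simp: power_divide power_mult_distrib field_simps intro!: add_mono)
    also have "\<dots> = heis_norm y / 2"
      unfolding real_root_mult heis_norm_def by (subst real_root_power_cancel) auto
    finally show ?thesis
      by (simp add: eq heis_norm_def)
  qed
  have step: "\<bar>K (X x (Suc k)) - K (X x k)\<bar> \<le> C * heis_norm x powr (- a) * q ^ k" for x k
    using near_diff_le[OF close[of "X x k"]] by (simp add: X_Suc norm_X_powr abs_minus_commute mult.assoc)
  have geo: "(\<lambda>k. C * heis_norm x powr (- a) * q ^ k) sums (C * heis_norm x powr (- a) * (1 / (1 - q)))" for x :: "'n heis"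
    using q by (intro sums_mult geometric_sums) auto
  \<comment> \<open>The increments of K along the ray are summed; adding the initial value K x turns
    the telescoping sum into the limit c x of K along the ray.\<close>
  define S where "S x = (\<Sum>k. K (X x (Suc k)) - K (X x k))" for x
  define c where "c x = S x + K x" for x
  have sm: "summable (\<lambda>k. norm (K (X x (Suc k)) - K (X x k)))" for x
    by (rule summable_comparison_test'[OF sums_summable[OF geo[of x]], of 0]) (use step in auto)
  have lim: "(\<lambda>k. K (X x k)) \<longlonglongrightarrow> c x" for x
  proof -
    have "(\<lambda>n. \<Sum>k<n. K (X x (Suc k)) - K (X x k)) \<longlonglongrightarrow> S x"
      unfolding S_def by (rule summable_LIMSEQ[OF summable_norm_cancel[OF sm]])
    moreover have "K (X x 0) = K x"
      by (simp add: X_def heis_dil_def)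
    ultimately have "(\<lambda>n. K (X x n) - K x) \<longlonglongrightarrow> S x"
      by (simp add: sum_lessThan_telescope[of "\<lambda>k. K (X x k)"])
    from tendsto_add[OF this tendsto_const[of "K x"]] show ?thesis
      by (simp add: c_def)
  qed
  have c_bound: "\<bar>K x - c x\<bar> \<le> C / (1 - q) * heis_norm x powr (- a)" for x
  proof -
    have "\<bar>S x\<bar> \<le> (\<Sum>k. norm (K (X x (Suc k)) - K (X x k)))"
      using summable_norm[OF sm[of x]] by (simp add: S_def)
    also have "\<dots> \<le> (\<Sum>k. C * heis_norm x powr (- a) * q ^ k)"
      by (rule suminf_le[OF _ sm sums_summable[OF geo]]) (use step in auto)
    also have "\<dots> = C * heis_norm x powr (- a) * (1 / (1 - q))"
      by (rule sums_unique[OF geo, symmetric])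
    finally show ?thesis
      by (simp add: c_def)
  qed
  \<comment> \<open>Dilations preserve the ratio of the distance to the norm, so the two rays stay
    comparable at every stage and the values of K on them differ by at most a multiple of
    q^k.\<close>
  have loc: "c x = c y" if xy: "heis_norm (heis_mult (heis_inv y) x) \<le> heis_norm x / 2" for x y
  proof -
    have "heis_norm (heis_mult (heis_inv (X y k)) (X x k)) \<le> heis_norm (X x k) / 2" for k
      using xy by (simp add: X_def heis_dil_inv heis_dil_mult heis_norm_dil l_def)
    then have le: "\<bar>K (X x k) - K (X y k)\<bar> \<le> C * heis_norm x powr (- a) * q ^ k" for k
      using near_diff_le[of "X y k" "X x k"] by (simp add: norm_X_powr mult.assoc)
    have "(\<lambda>k. K (X x k) - K (X y k)) \<longlonglongrightarrow> 0"
      by (rule Lim_null_comparison[OF _ summable_LIMSEQ_zero[OF sums_summable[OF geo[of x]]]])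
        (use le in auto)
    from LIMSEQ_unique[OF this tendsto_diff[OF lim lim]] show ?thesis by simp
  qed
  \<comment> \<open>The real dimension is 2n + 1, hence at least 2, and removing a point does not
    disconnect the space.\<close>
  have "connected (- {0 :: 'n heis})"
    by (rule connected_punctured_universe) (simp add: DIM_prod)
  then have const: "c x = c y" if "x \<noteq> 0" "y \<noteq> 0" for x y
  proof (rule connected_equivalence_relation[of _ x y "\<lambda>x y. c x = c y"])
    show "\<exists>T. openin (top_of_set (- {0})) T \<and> x \<in> T \<and> (\<forall>y\<in>T. c x = c y)" if "x \<in> - {0}" for x
    proof (intro exI conjI ballI)
      let ?T = "{y. heis_norm (heis_mult (heis_inv y) x) < heis_norm x / 2}"
      have "open ?T"
        by (intro open_Collect_less continuous_intros)
      then show "openin (top_of_set (- {0})) (- {0} \<inter> ?T)"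
        by (rule openin_open_Int)
      show "x \<in> - {0} \<inter> ?T"
        using that by simp
      show "c x = c y" if "y \<in> - {0} \<inter> ?T" for y
        using that by (intro loc) simp
    qed
  qed (use that in auto)
  obtain x0 :: "'n heis" where x0: "x0 \<noteq> 0"
    by (metis prod.inject zero_neq_one zero_prod_def)
  show ?thesis
  proof (rule that[of "C / (1 - q)" "c x0"])
    show "0 < C / (1 - q)" using C q by simp
    show "\<bar>K x - c x0\<bar> \<le> C / (1 - q) * heis_norm x powr (- a)" if "x \<noteq> 0" for x
      using c_bound[of x] const[OF that x0] by simp
  qed
qed

end

section \<open>Dyadic estimates for integrals against powers of a norm\<close>

text \<open>Handles the singularity at 0 (b = 1/2) and the tail at infinity (b = 2) together. On the
  layer s_k <= N < 2 s_k with s_k = R b^k the weight is at most s_k^(-a) and the mass of \<phi> at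
  most A (2 s_k)^\<theta>, so the layers contribute a geometric series of ratio b^(\<theta> -
  a).\<close>

lemma nn_integral_dyadic_le:
  fixes N :: "'a \<Rightarrow> real" and \<phi> :: "'a \<Rightarrow> ennreal"
  assumes [measurable]: "N \<in> borel_measurable M" "\<phi> \<in> borel_measurable M"
    and growth: "\<And>R. 0 < R \<Longrightarrow> (\<integral>\<^sup>+x. \<phi> x * indicator {x. N x < R} x \<partial>M) \<le> ennreal (A * R powr \<theta>)"
    and A: "0 \<le> A" and a: "0 \<le> a" and R: "0 < R" and b: "0 < b" "b powr (\<theta> - a) < 1"
    and cover: "\<And>x. x \<in> S \<Longrightarrow> \<exists>k. R * b ^ k \<le> N x \<and> N x < 2 * (R * b ^ k)"
  shows "(\<integral>\<^sup>+x. \<phi> x * ennreal (N x powr (- a)) * indicator S x \<partial>M)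
    \<le> ennreal (A * 2 powr \<theta> * R powr (\<theta> - a) / (1 - b powr (\<theta> - a)))"
proof -
  define s where "s k = R * b ^ k" for k :: nat
  have s: "0 < s k" for k using R b by (simp add: s_def)
  have "\<phi> x * ennreal (N x powr (- a)) * indicator S x
      \<le> (\<Sum>k. ennreal (s k powr (- a)) * (\<phi> x * indicator {x. N x < 2 * s k} x))" for x
  proof (cases "x \<in> S")
    case True
    then obtain k where k: "s k \<le> N x" "N x < 2 * s k"
      using cover[OF True] by (auto simp: s_def)
    have "N x powr (- a) \<le> s k powr (- a)"
      using k s[of k] a by (intro powr_mono2') auto
    then have "\<phi> x * ennreal (N x powr (- a)) * indicator S x
        \<le> ennreal (s k powr (- a)) * (\<phi> x * indicator {x. N x < 2 * s k} x)"
      using True k by (simp add: mult.commute mult_left_mono ennreal_leI)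
    also have "\<dots> \<le> (\<Sum>k. ennreal (s k powr (- a)) * (\<phi> x * indicator {x. N x < 2 * s k} x))"
      using sum_le_suminf[of "\<lambda>k. ennreal (s k powr (- a)) * (\<phi> x * indicator {x. N x < 2 * s k} x)" "{k}"]
      by simp
    finally show ?thesis .
  qed simp
  then have "(\<integral>\<^sup>+x. \<phi> x * ennreal (N x powr (- a)) * indicator S x \<partial>M)
      \<le> (\<integral>\<^sup>+x. (\<Sum>k. ennreal (s k powr (- a)) * (\<phi> x * indicator {x. N x < 2 * s k} x)) \<partial>M)"
    by (rule nn_integral_mono)
  also have "\<dots> = (\<Sum>k. ennreal (s k powr (- a)) * (\<integral>\<^sup>+x. \<phi> x * indicator {x. N x < 2 * s k} x \<partial>M))"
    by (subst nn_integral_suminf) (simp_all add: nn_integral_cmult)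
  also have "\<dots> \<le> (\<Sum>k. ennreal (A * 2 powr \<theta> * R powr (\<theta> - a) * (b powr (\<theta> - a)) ^ k))"
  proof (rule suminf_le)
    fix k
    have "ennreal (s k powr (- a)) * (\<integral>\<^sup>+x. \<phi> x * indicator {x. N x < 2 * s k} x \<partial>M)
        \<le> ennreal (s k powr (- a)) * ennreal (A * (2 * s k) powr \<theta>)"
      using s[of k] by (intro mult_left_mono growth) auto
    also have "\<dots> = ennreal (s k powr (- a) * (A * (2 * s k) powr \<theta>))"
      using A by (simp add: ennreal_mult)
    also have "s k powr (- a) * (A * (2 * s k) powr \<theta>) = A * 2 powr \<theta> * s k powr (\<theta> - a)"
      using s[of k] by (simp add: powr_mult powr_diff powr_minus divide_simps)
    also have "s k powr (\<theta> - a) = R powr (\<theta> - a) * (b powr (\<theta> - a)) ^ k"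
      using R b by (simp add: s_def powr_mult powr_powr powr_realpow[symmetric] mult.commute)
    finally show "ennreal (s k powr (- a)) * (\<integral>\<^sup>+x. \<phi> x * indicator {x. N x < 2 * s k} x \<partial>M)
        \<le> ennreal (A * 2 powr \<theta> * R powr (\<theta> - a) * (b powr (\<theta> - a)) ^ k)"
      by (simp add: mult.assoc)
  qed auto
  also have "\<dots> = ennreal (A * 2 powr \<theta> * R powr (\<theta> - a) * (1 / (1 - b powr (\<theta> - a))))"
    using A b by (intro suminf_ennreal_eq sums_mult geometric_sums) auto
  finally show ?thesis by simp
qed

lemma nn_integral_near_le:
  fixes N :: "'a \<Rightarrow> real" and \<phi> :: "'a \<Rightarrow> ennreal"
  assumes "N \<in> borel_measurable M" "\<phi> \<in> borel_measurable M"
    and "\<And>R. 0 < R \<Longrightarrow> (\<integral>\<^sup>+x. \<phi> x * indicator {x. N x < R} x \<partial>M) \<le> ennreal (A * R powr \<theta>)"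
    and "0 \<le> A" "0 \<le> a" and R: "0 < R" and a: "a < \<theta>"
  shows "(\<integral>\<^sup>+x. \<phi> x * ennreal (N x powr (- a)) * indicator {x. 0 < N x \<and> N x < R} x \<partial>M)
    \<le> ennreal (A * 2 powr \<theta> * (R / 2) powr (\<theta> - a) / (1 - (1 / 2) powr (\<theta> - a)))"
proof (rule nn_integral_dyadic_le[OF assms(1-5)])
  show "(1 / 2) powr (\<theta> - a) < 1"
    using a powr_less_mono2[of "\<theta> - a" "1 / 2" 1] by simp
  fix x assume "x \<in> {x. 0 < N x \<and> N x < R}"
  then have x: "0 < N x" "N x < R" by auto
  let ?P = "\<lambda>k. R / 2 * (1 / 2) ^ k \<le> N x"
  obtain n where "(1 / 2 :: real) ^ n < N x / R"
    using real_arch_pow_inv[of "N x / R" "1 / 2"] x R by auto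
  then have "?P n" using R x by (simp add: field_simps)
  \<comment> \<open>By minimality N x lies below the lower end of layer k - 1, which is twice the
    lower end of layer k. For k = 0 the upper end is R itself, whence the start at R / 2.\<close>
  define k where "k = (LEAST k. ?P k)"
  have k: "?P k" unfolding k_def by (rule LeastI[of ?P, OF \<open>?P n\<close>])
  have "N x < 2 * (R / 2 * (1 / 2) ^ k)"
  proof (cases k)
    case 0
    then show ?thesis using x by simp
  next
    case (Suc j)
    then have "\<not> ?P j" unfolding k_def by (metis lessI not_less_Least)
    then show ?thesis using Suc by simp
  qed
  with k show "\<exists>k. R / 2 * (1 / 2) ^ k \<le> N x \<and> N x < 2 * (R / 2 * (1 / 2) ^ k)" by blast
qed (use R in auto)

lemma nn_integral_far_le:
  fixes N :: "'a \<Rightarrow> real" and \<phi> :: "'a \<Rightarrow> ennreal"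
  assumes "N \<in> borel_measurable M" "\<phi> \<in> borel_measurable M"
    and "\<And>R. 0 < R \<Longrightarrow> (\<integral>\<^sup>+x. \<phi> x * indicator {x. N x < R} x \<partial>M) \<le> ennreal (A * R powr \<theta>)"
    and "0 \<le> A" "0 \<le> a" and R: "0 < R" and a: "\<theta> < a"
  shows "(\<integral>\<^sup>+x. \<phi> x * ennreal (N x powr (- a)) * indicator {x. R \<le> N x} x \<partial>M)
    \<le> ennreal (A * 2 powr \<theta> * R powr (\<theta> - a) / (1 - 2 powr (\<theta> - a)))"
proof (rule nn_integral_dyadic_le[OF assms(1-5)])
  show "2 powr (\<theta> - a) < 1"
    using a by (simp add: powr_less_one)
  fix x assume "x \<in> {x. R \<le> N x}"
  then have x: "R \<le> N x" by auto
  let ?P = "\<lambda>k. N x < 2 * (R * 2 ^ k)"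
  obtain n where "N x / R < 2 ^ n"
    using real_arch_pow[of 2 "N x / R"] by auto
  then have "?P n" using R x by (simp add: field_simps)
  \<comment> \<open>Now k is the first layer whose upper end exceeds N x; the upper end of layer k -
    1 is the lower end of layer k. For k = 0 the lower end is R.\<close>
  define k where "k = (LEAST k. ?P k)"
  have k: "?P k" unfolding k_def by (rule LeastI[of ?P, OF \<open>?P n\<close>])
  have "R * 2 ^ k \<le> N x"
  proof (cases k)
    case 0
    then show ?thesis using x by simp
  next
    case (Suc j)
    then have "\<not> ?P j" unfolding k_def by (metis lessI not_less_Least)
    then show ?thesis using Suc by simp
  qed
  with k show "\<exists>k. R * 2 ^ k \<le> N x \<and> N x < 2 * (R * 2 ^ k)" by blast
qed (use R in auto)

text \<open>A substitute for Hoelder's inequality: integrate the pointwise bound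
  \<open>y \<le> l + l powr (1 - p) * y powr p\<close> and optimise over \<open>l\<close>.\<close>
lemma nn_integral_le_powr_integral:
  fixes g :: "'a \<Rightarrow> real"
  assumes [measurable]: "g \<in> borel_measurable M" "B \<in> sets M"
    and p: "1 \<le> p" and D: "0 \<le> D" and V: "0 < V" "emeasure M B = ennreal V"
    and gp: "(\<integral>\<^sup>+x. ennreal (\<bar>g x\<bar> powr p) * indicator B x \<partial>M) \<le> ennreal D"
  shows "(\<integral>\<^sup>+x. ennreal \<bar>g x\<bar> * indicator B x \<partial>M) \<le> ennreal (2 * D powr (1 / p) * V powr (1 - 1 / p))"
\<comment> \<open>The case D = 0 is separate because the optimal l would be 0; there g vanishes
  almost everywhere on B.\<close>
proof (cases "D = 0")
  case True
  then have "AE x in M. ennreal (\<bar>g x\<bar> powr p) * indicator B x = 0"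
    using gp by (subst nn_integral_0_iff_AE[symmetric]) auto
  then have "AE x in M. ennreal \<bar>g x\<bar> * indicator B x = 0"
    by eventually_elim (auto simp: indicator_def split: if_splits)
  then have "(\<integral>\<^sup>+x. ennreal \<bar>g x\<bar> * indicator B x \<partial>M) = 0"
    by (subst nn_integral_0_iff_AE) auto
  then show ?thesis by simp
next
  case False
  then have D: "0 < D" using D by simp
  \<comment> \<open>This choice makes the two terms l V and l^(1-p) D equal, which accounts for the
    factor 2 in the result.\<close>
  define l where "l = (D / V) powr (1 / p)"
  have l: "0 < l" using D V by (simp add: l_def)
  have pt: "\<bar>g x\<bar> \<le> l + l powr (1 - p) * \<bar>g x\<bar> powr p" for x
  proof (cases "\<bar>g x\<bar> \<le> l")
    case True
    then show ?thesis by (simp add: add_increasing2)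
  next
    case False
    have "\<bar>g x\<bar> = \<bar>g x\<bar> powr (1 - p) * \<bar>g x\<bar> powr p"
      using False l by (simp flip: powr_add)
    also have "\<dots> \<le> l powr (1 - p) * \<bar>g x\<bar> powr p"
      using False l p by (intro mult_right_mono powr_mono2') auto
    finally show ?thesis using l by simp
  qed
  have "(\<integral>\<^sup>+x. ennreal \<bar>g x\<bar> * indicator B x \<partial>M)
      \<le> (\<integral>\<^sup>+x. ennreal l * indicator B x + ennreal (l powr (1 - p)) * (ennreal (\<bar>g x\<bar> powr p) * indicator B x) \<partial>M)"
    using l by (intro nn_integral_mono)
      (auto simp: indicator_def pt ennreal_mult[symmetric] ennreal_plus[symmetric] simp del: ennreal_plus intro!: ennreal_leI)
  also have "\<dots> = ennreal l * emeasure M B + ennreal (l powr (1 - p)) * (\<integral>\<^sup>+x. ennreal (\<bar>g x\<bar> powr p) * indicator B x \<partial>M)"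
    by (subst nn_integral_add) (simp_all add: nn_integral_cmult)
  also have "\<dots> \<le> ennreal l * ennreal V + ennreal (l powr (1 - p)) * ennreal D"
    unfolding V(2) by (intro add_mono mult_left_mono gp) auto
  also have "\<dots> = ennreal (l * V + l powr (1 - p) * D)"
    using l V D by (simp add: ennreal_mult)
  also have "l powr (1 - p) * D = l * V"
  proof -
    have "l powr p = D / V" using D V p by (simp add: l_def powr_powr)
    then show ?thesis using l D V by (simp add: powr_diff)
  qed
  also have "l * V = D powr (1 / p) * V powr (1 - 1 / p)"
    using D V by (simp add: l_def powr_divide powr_diff)
  finally show ?thesis by (simp add: mult.assoc)
qed

section \<open>Local and far parts of the potential\<close>

context regular_kernel
begin

text \<open>The decay |K - c| <= D |x|^(-a) is locally integrable since a < Q: the dyadic estimate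
  applies with \<phi> = 1, and its growth exponent is the one of ball volumes, Q.\<close>

lemma nn_integral_kernel_near:
  assumes aQ: "a < hdim TYPE('n)"
  obtains c E where "0 < E"
    "\<And>r. 0 < r \<Longrightarrow> (\<integral>\<^sup>+w. ennreal \<bar>K w - c\<bar> * indicator (heis_ball 0 r) w \<partial>lborel)
      \<le> ennreal (E * r powr (hdim TYPE('n) - a))"
proof -
  let ?Q = "hdim TYPE('n)" and ?V = "ball_volume TYPE('n)"
  obtain c D where D: "0 < D" and c: "\<And>x. x \<noteq> 0 \<Longrightarrow> \<bar>K x - c\<bar> \<le> D * heis_norm x powr (- a)"
    by (rule limit_at_infinity) blast
  define E where "E = D * (?V * 2 powr ?Q * (1 / 2) powr (?Q - a) / (1 - (1 / 2) powr (?Q - a)))"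
  have half: "(1 / 2) powr (?Q - a) < 1"
    using aQ powr_less_mono2[of "?Q - a" "1 / 2" 1] by simp
  have ball0: "heis_ball 0 r = {x :: 'n heis. heis_norm x < r}" for r
    by (auto simp: heis_ball_iff)
  show ?thesis
  proof (rule that[of E c])
    show "0 < E"
      using D half ball_volume_pos[where 'n='n] by (simp add: E_def)
    fix r :: real assume r: "0 < r"
    have "(\<integral>\<^sup>+w. ennreal \<bar>K w - c\<bar> * indicator (heis_ball 0 r) w \<partial>lborel)
        \<le> (\<integral>\<^sup>+w. ennreal D * (1 * ennreal (heis_norm w powr (- a)) * indicator {w. 0 < heis_norm w \<and> heis_norm w < r} (w :: 'n heis)) \<partial>lborel)"
    proof (rule nn_integral_mono_AE)
      \<comment> \<open>The decay bound excludes the origin, which is a null set.\<close>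
      have "AE w in lborel. w \<noteq> (0 :: 'n heis)"
        by (rule AE_lborel_singleton)
      then show "AE w in lborel. ennreal \<bar>K w - c\<bar> * indicator (heis_ball 0 r) w
          \<le> ennreal D * (1 * ennreal (heis_norm w powr (- a)) * indicator {w. 0 < heis_norm w \<and> heis_norm w < r} w)"
        by eventually_elim (use c D in \<open>auto simp: indicator_def ball0 ennreal_mult[symmetric] intro!: ennreal_leI\<close>)
    qed
    also have "\<dots> = ennreal D * (\<integral>\<^sup>+w. 1 * ennreal (heis_norm w powr (- a)) * indicator {w. 0 < heis_norm w \<and> heis_norm w < r} (w :: 'n heis) \<partial>lborel)"
      by (rule nn_integral_cmult) measurable
    also have "\<dots> \<le> ennreal D * ennreal (?V * 2 powr ?Q * (r / 2) powr (?Q - a) / (1 - (1 / 2) powr (?Q - a)))"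
    proof (intro mult_left_mono nn_integral_near_le)
      show "(\<integral>\<^sup>+w. 1 * indicator {w :: 'n heis. heis_norm w < R} w \<partial>lborel) \<le> ennreal (?V * R powr ?Q)" if "0 < R" for R
        using emeasure_heis_ball[OF that, of "0 :: 'n heis"] by (simp flip: ball0)
    qed (use r a aQ ball_volume_pos[where 'n='n] in auto)
    also have "\<dots> = ennreal (E * r powr (?Q - a))"
      using r D half ball_volume_pos[where 'n='n]
      by (subst ennreal_mult[symmetric]) (auto simp: E_def powr_divide)
    finally show "(\<integral>\<^sup>+w. ennreal \<bar>K w - c\<bar> * indicator (heis_ball 0 r) w \<partial>lborel) \<le> ennreal (E * r powr (?Q - a))" .
  qed
qed

text \<open>Regularity improves the decay of the kernel difference from -a to -(a + \<delta>), at
  the price of a factor r^\<delta>. The improved weight is integrable against g at infinity because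
  \<theta> < a + \<delta>, and the powers of r combine to r^(\<theta> - a).\<close>

lemma nn_integral_kernel_diff_far:
  fixes g :: "'n heis \<Rightarrow> real"
  assumes [measurable]: "g \<in> borel_measurable borel"
    and growth: "\<And>u R. 0 < R \<Longrightarrow> (\<integral>\<^sup>+v. ennreal \<bar>g v\<bar> * indicator (heis_ball u R) v \<partial>lborel) \<le> ennreal (G * R powr \<theta>)"
    and G: "0 \<le> G" and \<theta>: "\<theta> < a + \<delta>" and r: "0 < r" and u: "u \<in> heis_ball u0 r" "u' \<in> heis_ball u0 r"
  shows "(\<integral>\<^sup>+v. ennreal (\<bar>K (heis_mult (heis_inv v) u) - K (heis_mult (heis_inv v) u')\<bar> * \<bar>g v\<bar>) * indicator (- heis_ball u0 (5 * r)) v \<partial>lborel)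
    \<le> ennreal (C * 2 powr (\<delta> + (a + \<delta>) + \<theta>) * 5 powr (\<theta> - (a + \<delta>)) / (1 - 2 powr (\<theta> - (a + \<delta>))) * G * r powr (\<theta> - a))"
proof -
  define N where "N v = heis_norm (heis_mult (heis_inv u0) v)" for v
  have [measurable]: "N \<in> borel_measurable borel"
    unfolding N_def by measurable
  have ball: "heis_ball u0 R = {v. N v < R}" for R
    by (simp add: heis_ball_def N_def)
  have uN: "N u < r" "N u' < r" using u by (auto simp: ball)
  have uu': "heis_norm (heis_mult (heis_inv u') u) \<le> 2 * r"
    using heis_dist_triangle[of u' u u0] heis_norm_mult_inv_commute[of u' u0] uN by (simp add: N_def)
  define L where "L = C * (2 * r) powr \<delta> * 2 powr (a + \<delta>)"
  have L: "0 < L" using C r by (simp add: L_def)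
  \<comment> \<open>The factor 5 is chosen for this step: v at distance at least 5 r from u0 is at
    distance at least 4 r from u, twice the largest possible distance 2 r between u and u'. Also N v
    - r >= N v / 2, which produces the factor 2^(a + \<delta>) in L.\<close>
  have K_le: "\<bar>K (heis_mult (heis_inv v) u) - K (heis_mult (heis_inv v) u')\<bar> \<le> L * N v powr (- (a + \<delta>))"
    if v: "5 * r \<le> N v" for v
  proof -
    let ?x = "heis_mult (heis_inv v) u" and ?y = "heis_mult (heis_inv v) u'"
    have yx: "heis_mult (heis_inv ?y) ?x = heis_mult (heis_inv u') u"
      by (simp add: heis_inv_mult heis_mult_assoc)
    have x: "N v - r \<le> heis_norm ?x"
      using heis_dist_triangle[of u0 v u] heis_norm_mult_inv_commute[of u v] uN by (simp add: N_def)
    have "\<bar>K ?x - K ?y\<bar> \<le> C * heis_norm (heis_mult (heis_inv ?y) ?x) powr \<delta> / heis_norm ?x powr (a + \<delta>)"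
      by (rule regular) (use yx uu' x v in auto)
    also have "\<dots> \<le> C * (2 * r) powr \<delta> / (N v / 2) powr (a + \<delta>)"
      unfolding yx using uu' x v r C a \<delta> by (intro frac_le mult_left_mono mult_nonneg_nonneg powr_mono2) auto
    also have "\<dots> = L * N v powr (- (a + \<delta>))"
      using v r by (simp add: L_def powr_divide powr_minus_divide del: minus_add_distrib)
    finally show ?thesis .
  qed
  have "(\<integral>\<^sup>+v. ennreal (\<bar>K (heis_mult (heis_inv v) u) - K (heis_mult (heis_inv v) u')\<bar> * \<bar>g v\<bar>) * indicator (- heis_ball u0 (5 * r)) v \<partial>lborel)
      \<le> (\<integral>\<^sup>+v. ennreal L * (ennreal \<bar>g v\<bar> * ennreal (N v powr (- (a + \<delta>))) * indicator {v. 5 * r \<le> N v} v) \<partial>lborel)"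
  proof (rule nn_integral_mono)
    fix v
    show "ennreal (\<bar>K (heis_mult (heis_inv v) u) - K (heis_mult (heis_inv v) u')\<bar> * \<bar>g v\<bar>) * indicator (- heis_ball u0 (5 * r)) v
        \<le> ennreal L * (ennreal \<bar>g v\<bar> * ennreal (N v powr (- (a + \<delta>))) * indicator {v. 5 * r \<le> N v} v)"
    proof (cases "5 * r \<le> N v")
      case True
      have "ennreal (\<bar>K (heis_mult (heis_inv v) u) - K (heis_mult (heis_inv v) u')\<bar> * \<bar>g v\<bar>)
          \<le> ennreal (L * N v powr (- (a + \<delta>)) * \<bar>g v\<bar>)"
        by (intro ennreal_leI mult_right_mono K_le[OF True]) simp
      also have "\<dots> = ennreal L * (ennreal \<bar>g v\<bar> * ennreal (N v powr (- (a + \<delta>))))"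
        using L by (simp add: ennreal_mult ac_simps del: minus_add_distrib)
      finally show ?thesis using True by (simp add: ball del: minus_add_distrib)
    qed (simp add: ball)
  qed
  also have "\<dots> = ennreal L * (\<integral>\<^sup>+v. ennreal \<bar>g v\<bar> * ennreal (N v powr (- (a + \<delta>))) * indicator {v. 5 * r \<le> N v} v \<partial>lborel)"
    by (rule nn_integral_cmult) measurable
  also have "\<dots> \<le> ennreal L * ennreal (G * 2 powr \<theta> * (5 * r) powr (\<theta> - (a + \<delta>)) / (1 - 2 powr (\<theta> - (a + \<delta>))))"
    using growth G r a \<delta> \<theta> by (intro mult_left_mono nn_integral_far_le) (auto simp flip: ball)
  also have "\<dots> = ennreal (L * (G * 2 powr \<theta> * (5 * r) powr (\<theta> - (a + \<delta>)) / (1 - 2 powr (\<theta> - (a + \<delta>)))))"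
    using L by (subst ennreal_mult') auto
  also have "L * (G * 2 powr \<theta> * (5 * r) powr (\<theta> - (a + \<delta>)) / (1 - 2 powr (\<theta> - (a + \<delta>))))
      = C * 2 powr (\<delta> + (a + \<delta>) + \<theta>) * 5 powr (\<theta> - (a + \<delta>)) / (1 - 2 powr (\<theta> - (a + \<delta>))) * G * r powr (\<delta> + (\<theta> - (a + \<delta>)))"
    using r by (simp only: L_def powr_mult powr_add) (simp add: ac_simps)
  finally show ?thesis by simp
qed

text \<open>After exchanging the integrals, the u-integral involves only the kernel and is bounded
  uniformly in v by translation invariance; what remains is the mass of g on the larger
  ball.\<close>

lemma nn_integral_potential_near:
  fixes g :: "'n heis \<Rightarrow> real"
  assumes [measurable]: "g \<in> borel_measurable borel"
    and near: "\<And>r. 0 < r \<Longrightarrow> (\<integral>\<^sup>+w. ennreal \<bar>K w - c\<bar> * indicator (heis_ball 0 r) w \<partial>lborel) \<le> ennreal (E * r powr \<gamma>)"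
    and growth: "\<And>u R. 0 < R \<Longrightarrow> (\<integral>\<^sup>+v. ennreal \<bar>g v\<bar> * indicator (heis_ball u R) v \<partial>lborel) \<le> ennreal (G * R powr \<theta>)"
    and E: "0 \<le> E" and G: "0 \<le> G" and r: "0 < r"
  shows "(\<integral>\<^sup>+u. (\<integral>\<^sup>+v. ennreal (\<bar>K (heis_mult (heis_inv v) u) - c\<bar> * \<bar>g v\<bar>) * indicator (heis_ball u0 (5 * r)) v \<partial>lborel) * indicator (heis_ball u0 r) u \<partial>lborel)
    \<le> ennreal (E * 6 powr \<gamma> * 5 powr \<theta> * G * r powr (\<gamma> + \<theta>))"
proof -
  let ?B = "heis_ball u0 r" and ?B' = "heis_ball u0 (5 * r)"
  let ?k = "\<lambda>u v. ennreal \<bar>K (heis_mult (heis_inv v) u) - c\<bar>"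
  have inner: "(\<integral>\<^sup>+u. ?k u v * indicator ?B u \<partial>lborel) \<le> ennreal (E * (6 * r) powr \<gamma>)" if v: "v \<in> ?B'" for v
  proof -
    \<comment> \<open>The radius is 6 r = 5 r + r, by the triangle inequality through u0.\<close>
    have sub: "heis_mult (heis_inv v) u \<in> heis_ball 0 (6 * r)" if "u \<in> ?B" for u
      using that v heis_dist_triangle[of v u u0] heis_norm_mult_inv_commute[of v u0] by (simp add: heis_ball_iff)
    have "(\<integral>\<^sup>+u. ?k u v * indicator ?B u \<partial>lborel)
        \<le> (\<integral>\<^sup>+u. ?k u v * indicator (heis_ball 0 (6 * r)) (heis_mult (heis_inv v) u) \<partial>lborel)"
      by (intro nn_integral_mono) (auto simp: indicator_def sub)
    also have "\<dots> = (\<integral>\<^sup>+w. ennreal \<bar>K w - c\<bar> * indicator (heis_ball 0 (6 * r)) w \<partial>lborel)"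
      by (rule nn_integral_heis_mult) measurable
    also have "\<dots> \<le> ennreal (E * (6 * r) powr \<gamma>)"
      using r by (intro near) simp
    finally show ?thesis .
  qed
  have "(\<integral>\<^sup>+u. (\<integral>\<^sup>+v. ennreal (\<bar>K (heis_mult (heis_inv v) u) - c\<bar> * \<bar>g v\<bar>) * indicator ?B' v \<partial>lborel) * indicator ?B u \<partial>lborel)
      = (\<integral>\<^sup>+u. (\<integral>\<^sup>+v. ennreal \<bar>g v\<bar> * indicator ?B' v * (?k u v * indicator ?B u) \<partial>lborel) \<partial>lborel)"
    by (subst nn_integral_multc[symmetric]) (auto simp: ennreal_mult ac_simps)
  also have "\<dots> = (\<integral>\<^sup>+v. (\<integral>\<^sup>+u. ennreal \<bar>g v\<bar> * indicator ?B' v * (?k u v * indicator ?B u) \<partial>lborel) \<partial>lborel)"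
    by (rule lborel_pair.Fubini') measurable
  also have "\<dots> = (\<integral>\<^sup>+v. ennreal \<bar>g v\<bar> * indicator ?B' v * (\<integral>\<^sup>+u. ?k u v * indicator ?B u \<partial>lborel) \<partial>lborel)"
    by (intro nn_integral_cong nn_integral_cmult) measurable
  also have "\<dots> \<le> (\<integral>\<^sup>+v. ennreal \<bar>g v\<bar> * indicator ?B' v * ennreal (E * (6 * r) powr \<gamma>) \<partial>lborel)"
  proof (rule nn_integral_mono)
    show "ennreal \<bar>g v\<bar> * indicator ?B' v * (\<integral>\<^sup>+u. ?k u v * indicator ?B u \<partial>lborel)
        \<le> ennreal \<bar>g v\<bar> * indicator ?B' v * ennreal (E * (6 * r) powr \<gamma>)" for v
      by (cases "v \<in> ?B'") (auto intro!: mult_left_mono inner)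
  qed
  also have "\<dots> = (\<integral>\<^sup>+v. ennreal \<bar>g v\<bar> * indicator ?B' v \<partial>lborel) * ennreal (E * (6 * r) powr \<gamma>)"
    by (rule nn_integral_multc) measurable
  also have "\<dots> \<le> ennreal (G * (5 * r) powr \<theta>) * ennreal (E * (6 * r) powr \<gamma>)"
    using r by (intro mult_right_mono growth) auto
  also have "\<dots> = ennreal (G * (5 * r) powr \<theta> * (E * (6 * r) powr \<gamma>))"
    using E G by (intro ennreal_mult[symmetric]) auto
  also have "G * (5 * r) powr \<theta> * (E * (6 * r) powr \<gamma>) = E * 6 powr \<gamma> * 5 powr \<theta> * G * r powr (\<gamma> + \<theta>)"
    using r by (simp add: powr_mult powr_add ac_simps)
  finally show ?thesis .
qed

text \<open>Combines the local and the far estimate. The constant E is chosen before g, G and the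
  ball, so the bound is uniform over all balls and linear in G.\<close>

lemma potential_oscillation:
  assumes aQ: "a < hdim TYPE('n)" and \<theta>: "\<theta> < a + \<delta>"
  obtains E where "0 < E"
    "\<And>g G u0 r. g \<in> borel_measurable borel \<Longrightarrow> 0 \<le> G \<Longrightarrow> 0 < r \<Longrightarrow>
      (\<And>u R. 0 < R \<Longrightarrow> (\<integral>\<^sup>+v. ennreal \<bar>g v\<bar> * indicator (heis_ball u R) v \<partial>lborel) \<le> ennreal (G * R powr \<theta>)) \<Longrightarrow>
      AE u in lborel. integrable lborel (\<lambda>v. K (heis_mult (heis_inv v) u) * g v) \<Longrightarrow>
      \<exists>m. (\<integral>\<^sup>+u. ennreal \<bar>(\<integral>v. K (heis_mult (heis_inv v) u) * g v \<partial>lborel) - m\<bar> * indicator (heis_ball u0 r) u \<partial>lborel)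
        \<le> ennreal (E * G * r powr (hdim TYPE('n) + \<theta> - a))"
proof -
  let ?Q = "hdim TYPE('n)" and ?V = "ball_volume TYPE('n)"
  obtain c E1 where E1: "0 < E1"
    and near: "\<And>r. 0 < r \<Longrightarrow> (\<integral>\<^sup>+w. ennreal \<bar>K w - c\<bar> * indicator (heis_ball 0 r) w \<partial>lborel) \<le> ennreal (E1 * r powr (?Q - a))"
    by (rule nn_integral_kernel_near[OF aQ]) blast
  define E2 where "E2 = C * 2 powr (\<delta> + (a + \<delta>) + \<theta>) * 5 powr (\<theta> - (a + \<delta>)) / (1 - 2 powr (\<theta> - (a + \<delta>)))"
  have E2: "0 < E2"
    unfolding E2_def using C \<theta> by (intro divide_pos_pos mult_pos_pos) (auto simp: powr_less_one)
  define E where "E = E1 * 6 powr (?Q - a) * 5 powr \<theta> + E2 * ?V"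
  show ?thesis
  proof (rule that[of E])
    show "0 < E" using E1 E2 ball_volume_pos[where 'n='n] by (simp add: E_def add_pos_pos)
    fix g :: "'n heis \<Rightarrow> real" and G r :: real and u0 :: "'n heis"
    assume g [measurable]: "g \<in> borel_measurable borel" and G: "0 \<le> G" and r: "0 < r"
      and growth: "\<And>u R. 0 < R \<Longrightarrow> (\<integral>\<^sup>+v. ennreal \<bar>g v\<bar> * indicator (heis_ball u R) v \<partial>lborel) \<le> ennreal (G * R powr \<theta>)"
      and int: "AE u in lborel. integrable lborel (\<lambda>v. K (heis_mult (heis_inv v) u) * g v)"
    let ?B = "heis_ball u0 r" and ?B' = "heis_ball u0 (5 * r)"
    let ?k = "\<lambda>u v. K (heis_mult (heis_inv v) u)"
    \<comment> \<open>The ball has positive measure, so it contains a point at which the potential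
      integral converges. It serves as reference point for the far part.\<close>
    obtain u1 where u1: "u1 \<in> ?B" and int1: "integrable lborel (\<lambda>v. ?k u1 v * g v)"
    proof (rule ccontr)
      assume *: "\<not> thesis"
      have "AE u in lborel. u \<notin> ?B"
        using int by eventually_elim (use * that in blast)
      then have "emeasure lborel {u \<in> space lborel. u \<in> ?B} = 0"
        by (rule emeasure_eq_0_AE)
      then show False
        using emeasure_heis_ball[OF r, of u0] r ball_volume_pos[where 'n='n] by (simp add: mult_le_0_iff)
    qed
    have gB: "integrable lborel (\<lambda>v. g v * indicator ?B' v)"
    proof (rule integrableI_bounded)
      have "(\<integral>\<^sup>+v. ennreal (norm (g v * indicator ?B' v)) \<partial>lborel) = (\<integral>\<^sup>+v. ennreal \<bar>g v\<bar> * indicator ?B' v \<partial>lborel)"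
        by (intro nn_integral_cong) (auto simp: indicator_def)
      also have "\<dots> \<le> ennreal (G * (5 * r) powr \<theta>)" using r by (intro growth) simp
      finally show "(\<integral>\<^sup>+v. ennreal (norm (g v * indicator ?B' v)) \<partial>lborel) < \<infinity>"
        by (simp add: le_less_trans)
    qed measurable
    \<comment> \<open>The approximating constant consists of c times the integral of g over the
      larger ball and the far potential frozen at u1. Subtracting it leaves K - c on the local part
      and a kernel difference on the far part.\<close>
    define m where "m = (\<integral>v. c * (g v * indicator ?B' v) \<partial>lborel) + (\<integral>v. ?k u1 v * g v * indicator (- ?B') v \<partial>lborel)"
    have pt: "ennreal \<bar>(\<integral>v. ?k u v * g v \<partial>lborel) - m\<bar>
        \<le> (\<integral>\<^sup>+v. ennreal (\<bar>?k u v - c\<bar> * \<bar>g v\<bar>) * indicator ?B' v \<partial>lborel) + ennreal (E2 * G * r powr (\<theta> - a))"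
      if u: "u \<in> ?B" and intu: "integrable lborel (\<lambda>v. ?k u v * g v)" for u
    proof -
      have near_int: "integrable lborel (\<lambda>v. ?k w v * g v * indicator ?B' v)"
        and far_int: "integrable lborel (\<lambda>v. ?k w v * g v * indicator (- ?B') v)"
        if "integrable lborel (\<lambda>v. ?k w v * g v)" for w
        using that by (auto intro!: integrable_real_mult_indicator)
      have "(\<integral>v. ?k u v * g v \<partial>lborel) = (\<integral>v. ?k u v * g v * indicator ?B' v + ?k u v * g v * indicator (- ?B') v \<partial>lborel)"
        by (intro Bochner_Integration.integral_cong) (auto simp: indicator_def)
      also have "\<dots> = (\<integral>v. ?k u v * g v * indicator ?B' v \<partial>lborel) + (\<integral>v. ?k u v * g v * indicator (- ?B') v \<partial>lborel)"
        by (intro Bochner_Integration.integral_add near_int far_int intu)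
      finally have "(\<integral>v. ?k u v * g v \<partial>lborel) - m
          = ((\<integral>v. ?k u v * g v * indicator ?B' v \<partial>lborel) - (\<integral>v. c * (g v * indicator ?B' v) \<partial>lborel))
            + ((\<integral>v. ?k u v * g v * indicator (- ?B') v \<partial>lborel) - (\<integral>v. ?k u1 v * g v * indicator (- ?B') v \<partial>lborel))"
        by (simp add: m_def)
      also have "\<dots> = (\<integral>v. ?k u v * g v * indicator ?B' v - c * (g v * indicator ?B' v) \<partial>lborel)
            + (\<integral>v. ?k u v * g v * indicator (- ?B') v - ?k u1 v * g v * indicator (- ?B') v \<partial>lborel)"
        using gB by (simp add: near_int far_int intu int1)
      also have "\<dots> = (\<integral>v. (?k u v - c) * g v * indicator ?B' v \<partial>lborel)
            + (\<integral>v. (?k u v - ?k u1 v) * g v * indicator (- ?B') v \<partial>lborel)"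
        by (simp add: algebra_simps)
      finally have eq: "(\<integral>v. ?k u v * g v \<partial>lborel) - m = (\<integral>v. (?k u v - c) * g v * indicator ?B' v \<partial>lborel)
            + (\<integral>v. (?k u v - ?k u1 v) * g v * indicator (- ?B') v \<partial>lborel)" .
      have "ennreal \<bar>(\<integral>v. (?k u v - c) * g v * indicator ?B' v \<partial>lborel)\<bar>
          \<le> (\<integral>\<^sup>+v. ennreal (norm ((?k u v - c) * g v * indicator ?B' v)) \<partial>lborel)"
        using integral_norm_bound_ennreal[of lborel "\<lambda>v. (?k u v - c) * g v * indicator ?B' v"]
          Bochner_Integration.integrable_diff[OF near_int[OF intu] integrable_mult_right[OF gB, of c]]
        by (simp add: algebra_simps)
      also have "\<dots> = (\<integral>\<^sup>+v. ennreal (\<bar>?k u v - c\<bar> * \<bar>g v\<bar>) * indicator ?B' v \<partial>lborel)"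
        by (intro nn_integral_cong) (auto simp: indicator_def abs_mult)
      finally have 1: "ennreal \<bar>(\<integral>v. (?k u v - c) * g v * indicator ?B' v \<partial>lborel)\<bar>
          \<le> (\<integral>\<^sup>+v. ennreal (\<bar>?k u v - c\<bar> * \<bar>g v\<bar>) * indicator ?B' v \<partial>lborel)" .
      have "ennreal \<bar>(\<integral>v. (?k u v - ?k u1 v) * g v * indicator (- ?B') v \<partial>lborel)\<bar>
          \<le> (\<integral>\<^sup>+v. ennreal (norm ((?k u v - ?k u1 v) * g v * indicator (- ?B') v)) \<partial>lborel)"
        using integral_norm_bound_ennreal[of lborel "\<lambda>v. (?k u v - ?k u1 v) * g v * indicator (- ?B') v"]
          Bochner_Integration.integrable_diff[OF far_int[OF intu] far_int[OF int1]]
        by (simp add: algebra_simps)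
      also have "\<dots> = (\<integral>\<^sup>+v. ennreal (\<bar>?k u v - ?k u1 v\<bar> * \<bar>g v\<bar>) * indicator (- ?B') v \<partial>lborel)"
        by (intro nn_integral_cong) (auto simp: indicator_def abs_mult)
      also have "\<dots> \<le> ennreal (E2 * G * r powr (\<theta> - a))"
        unfolding E2_def by (rule nn_integral_kernel_diff_far[OF g growth G \<theta> r u u1])
      finally have 2: "ennreal \<bar>(\<integral>v. (?k u v - ?k u1 v) * g v * indicator (- ?B') v \<partial>lborel)\<bar> \<le> ennreal (E2 * G * r powr (\<theta> - a))" .
      have "ennreal \<bar>(\<integral>v. ?k u v * g v \<partial>lborel) - m\<bar>
          \<le> ennreal \<bar>(\<integral>v. (?k u v - c) * g v * indicator ?B' v \<partial>lborel)\<bar>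
            + ennreal \<bar>(\<integral>v. (?k u v - ?k u1 v) * g v * indicator (- ?B') v \<partial>lborel)\<bar>"
        unfolding eq by (subst ennreal_plus[symmetric]) (auto intro!: ennreal_leI simp del: ennreal_plus)
      then show ?thesis
        using add_mono[OF 1 2] by (rule order_trans)
    qed
    have "(\<integral>\<^sup>+u. ennreal \<bar>(\<integral>v. ?k u v * g v \<partial>lborel) - m\<bar> * indicator ?B u \<partial>lborel)
        \<le> (\<integral>\<^sup>+u. (\<integral>\<^sup>+v. ennreal (\<bar>?k u v - c\<bar> * \<bar>g v\<bar>) * indicator ?B' v \<partial>lborel) * indicator ?B u
            + ennreal (E2 * G * r powr (\<theta> - a)) * indicator ?B u \<partial>lborel)"
    proof (rule nn_integral_mono_AE)
      show "AE u in lborel. ennreal \<bar>(\<integral>v. ?k u v * g v \<partial>lborel) - m\<bar> * indicator ?B u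
          \<le> (\<integral>\<^sup>+v. ennreal (\<bar>?k u v - c\<bar> * \<bar>g v\<bar>) * indicator ?B' v \<partial>lborel) * indicator ?B u
            + ennreal (E2 * G * r powr (\<theta> - a)) * indicator ?B u"
        using int
      proof eventually_elim
        case (elim u)
        then show ?case
          using pt[of u] by (cases "u \<in> ?B") simp_all
      qed
    qed
    also have "\<dots> = (\<integral>\<^sup>+u. (\<integral>\<^sup>+v. ennreal (\<bar>?k u v - c\<bar> * \<bar>g v\<bar>) * indicator ?B' v \<partial>lborel) * indicator ?B u \<partial>lborel)
            + ennreal (E2 * G * r powr (\<theta> - a)) * emeasure lborel ?B"
      by (subst nn_integral_add) (simp_all add: nn_integral_cmult)
    also have "\<dots> \<le> ennreal (E1 * 6 powr (?Q - a) * 5 powr \<theta> * G * r powr (?Q - a + \<theta>))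
            + ennreal (E2 * G * r powr (\<theta> - a)) * ennreal (?V * r powr ?Q)"
      unfolding emeasure_heis_ball[OF r]
      using E1 by (intro add_right_mono nn_integral_potential_near[OF g near growth] G r) auto
    also have "\<dots> = ennreal (E1 * 6 powr (?Q - a) * 5 powr \<theta> * G * r powr (?Q - a + \<theta>)
            + E2 * G * r powr (\<theta> - a) * (?V * r powr ?Q))"
      using E1 E2 G ball_volume_pos[where 'n='n] by (simp add: ennreal_mult ennreal_plus)
    \<comment> \<open>Both contributions scale alike: integrating the far bound r^(\<theta> - a)
      over the ball multiplies it by V r^Q.\<close>
    also have "E1 * 6 powr (?Q - a) * 5 powr \<theta> * G * r powr (?Q - a + \<theta>)
            + E2 * G * r powr (\<theta> - a) * (?V * r powr ?Q) = E * G * r powr (?Q + \<theta> - a)"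
      using r by (simp add: E_def powr_add powr_diff field_simps)
    finally show "\<exists>m. (\<integral>\<^sup>+u. ennreal \<bar>(\<integral>v. ?k u v * g v \<partial>lborel) - m\<bar> * indicator ?B u \<partial>lborel)
        \<le> ennreal (E * G * r powr (?Q + \<theta> - a))" by blast
  qed
qed

end

section \<open>Campanato and Morrey norms\<close>

text \<open>Any constant m may replace the mean at the cost of a factor 2, since |F_B - m| |B| is at
  most the integral of |F - m| over B. This allows m to vary with the ball in an uncontrolled
  way.\<close>

lemma campanato_of_oscillation:
  fixes F :: "'n::finite heis \<Rightarrow> real"
  assumes F [measurable]: "F \<in> borel_measurable borel" and A: "0 \<le> A"
    and osc: "\<And>u r. 0 < r \<Longrightarrow> \<exists>m. (\<integral>\<^sup>+v. ennreal \<bar>F v - m\<bar> * indicator (heis_ball u r) v \<partial>lborel)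
      \<le> ennreal (A * r powr (hdim TYPE('n) + \<beta>))"
  shows "in_campanato \<beta> F" and "campanato_norm \<beta> F \<le> 2 * A * ball_volume TYPE('n) powr (- 1 - \<beta> / hdim TYPE('n))"
proof -
  let ?Q = "hdim TYPE('n)" and ?V = "ball_volume TYPE('n)"
  have Q: "0 < ?Q" by (simp add: hdim_def add_pos_pos)
  have Fl [measurable]: "F \<in> borel_measurable lebesgue"
    by (simp add: measurable_completion)
  have key: "set_integrable lebesgue (heis_ball u r) F \<and>
      measure lebesgue (heis_ball u r) powr (- 1 - \<beta> / ?Q) *
        (LINT v:heis_ball u r|lebesgue. \<bar>F v - ball_avg F (heis_ball u r)\<bar>) \<le> 2 * A * ?V powr (- 1 - \<beta> / ?Q)"
    if r: "0 < r" for u r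
  proof -
    let ?B = "heis_ball u r"
    have B [measurable]: "?B \<in> sets lebesgue"
      by (simp add: lborelD)
    define b where "b = measure lebesgue ?B"
    have b_eq: "b = ?V * r powr ?Q"
      unfolding b_def by (rule measure_heis_ball[OF r])
    have b: "0 < b" using ball_volume_pos[where 'n='n] r by (simp add: b_eq)
    have const: "set_integrable lebesgue ?B (\<lambda>_. x)" for x :: real
      unfolding set_integrable_def using emeasure_heis_ball[OF r, of u]
      by (intro integrable_scaleR_left integrable_real_indicator) (auto simp: emeasure_completion)
    have LINT_const: "(LINT v:?B|lebesgue. x) = x * b" for x :: real
      by (simp add: set_lebesgue_integral_def b_def)
    obtain m where m: "(\<integral>\<^sup>+v. ennreal \<bar>F v - m\<bar> * indicator ?B v \<partial>lborel) \<le> ennreal (A * r powr (?Q + \<beta>))"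
      using osc[OF r] by blast
    have nn: "(\<integral>\<^sup>+v. ennreal (norm (indicator ?B v *\<^sub>R (F v - m))) \<partial>lebesgue) \<le> ennreal (A * r powr (?Q + \<beta>))"
    proof -
      have "(\<integral>\<^sup>+v. ennreal (norm (indicator ?B v *\<^sub>R (F v - m))) \<partial>lebesgue) = (\<integral>\<^sup>+v. ennreal \<bar>F v - m\<bar> * indicator ?B v \<partial>lborel)"
        unfolding nn_integral_completion by (intro nn_integral_cong) (auto simp: indicator_def)
      then show ?thesis using m by simp
    qed
    have Fm: "set_integrable lebesgue ?B (\<lambda>v. F v - m)"
      unfolding set_integrable_def using nn
      by (intro integrableI_bounded) (measurable, simp add: le_less_trans)
    have int: "set_integrable lebesgue ?B F"
      using set_integral_add(1)[OF Fm const[of m]] by simp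
    define I where "I = (LINT v:?B|lebesgue. \<bar>F v - m\<bar>)"
    have I: "I \<le> A * r powr (?Q + \<beta>)"
    proof -
      have "ennreal I = (\<integral>\<^sup>+v. ennreal (norm (indicator ?B v *\<^sub>R (F v - m))) \<partial>lebesgue)"
        unfolding I_def set_lebesgue_integral_def
        using Fm[unfolded set_integrable_def, THEN integrable_norm]
        by (subst nn_integral_eq_integral) (auto simp: abs_mult)
      also note nn
      finally show ?thesis using A by simp
    qed
    have "\<bar>(LINT v:?B|lebesgue. F v - m)\<bar> \<le> I"
      unfolding I_def using set_integral_norm_bound[OF Fm] by simp
    moreover have "(LINT v:?B|lebesgue. F v - m) = (ball_avg F ?B - m) * b"
      using b by (simp add: set_integral_diff(2)[OF int const] LINT_const ball_avg_def algebra_simps flip: b_def)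
    ultimately have avg: "\<bar>ball_avg F ?B - m\<bar> * b \<le> I"
      using b by (simp add: abs_mult)
    have "(LINT v:?B|lebesgue. \<bar>F v - ball_avg F ?B\<bar>) \<le> (LINT v:?B|lebesgue. \<bar>F v - m\<bar> + \<bar>ball_avg F ?B - m\<bar>)"
      by (intro set_integral_mono set_integral_add set_integrable_abs set_integral_diff int const) auto
    also have "\<dots> = I + \<bar>ball_avg F ?B - m\<bar> * b"
      unfolding I_def by (subst set_integral_add(2)[OF set_integrable_abs[OF Fm] const]) (simp add: LINT_const)
    also have "\<dots> \<le> 2 * (A * r powr (?Q + \<beta>))"
      using avg I by simp
    finally have "b powr (- 1 - \<beta> / ?Q) * (LINT v:?B|lebesgue. \<bar>F v - ball_avg F ?B\<bar>)
        \<le> b powr (- 1 - \<beta> / ?Q) * (2 * (A * r powr (?Q + \<beta>)))"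
      by (rule mult_left_mono) simp
    also have "\<dots> = 2 * A * ?V powr (- 1 - \<beta> / ?Q) * (r powr (?Q * (- 1 - \<beta> / ?Q)) * r powr (?Q + \<beta>))"
      using r ball_volume_pos[where 'n='n] by (simp add: b_eq powr_mult powr_powr)
    \<comment> \<open>The total exponent Q (-1 - \<beta>/Q) + Q + \<beta> is zero, so the bound no
      longer depends on the ball and controls the supremum.\<close>
    also have "r powr (?Q * (- 1 - \<beta> / ?Q)) * r powr (?Q + \<beta>) = 1"
      using r Q by (simp add: algebra_simps flip: powr_add)
    finally show ?thesis using int by (simp add: b_def)
  qed
  then show "in_campanato \<beta> F"
    unfolding in_campanato_def
    by (intro conjI Fl allI impI bdd_aboveI[of _ "2 * A * ?V powr (- 1 - \<beta> / ?Q)"]) (auto simp: campanato_vals_def)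
  show "campanato_norm \<beta> F \<le> 2 * A * ?V powr (- 1 - \<beta> / ?Q)"
    unfolding campanato_norm_def
  proof (rule cSup_least)
    show "campanato_vals \<beta> F \<noteq> {}"
      unfolding campanato_vals_def using zero_less_one by blast
  qed (use key in \<open>auto simp: campanato_vals_def\<close>)
qed

text \<open>Applies \<open>nn_integral_le_powr_integral\<close> with V = |B| and D = M |B|^\<kappa>,
  where M is the supremum defining the Morrey norm before its p-th root. The Borel representative g
  replaces f so that the \<open>lborel\<close> estimates apply.\<close>

lemma morrey_growth:
  fixes f g :: "'n::finite heis \<Rightarrow> real"
  assumes f: "in_morrey p \<kappa> f" and p: "1 \<le> p"
    and g [measurable]: "g \<in> borel_measurable borel" and fg: "AE v in lborel. f v = g v" and R: "0 < R"
  shows "(\<integral>\<^sup>+v. ennreal \<bar>g v\<bar> * indicator (heis_ball u R) v \<partial>lborel)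
    \<le> ennreal (2 * ball_volume TYPE('n) powr (1 - (1 - \<kappa>) / p) * morrey_norm p \<kappa> f
        * R powr (hdim TYPE('n) * (1 - (1 - \<kappa>) / p)))"
proof -
  let ?B = "heis_ball u R" and ?M = "Sup (morrey_vals p \<kappa> f)"
  define b where "b = ball_volume TYPE('n) * R powr hdim TYPE('n)"
  have b: "0 < b" using R ball_volume_pos[where 'n='n] by (simp add: b_def)
  have mb: "measure lebesgue ?B = b" unfolding b_def by (rule measure_heis_ball[OF R])
  have bdd: "bdd_above (morrey_vals p \<kappa> f)"
    using f by (simp add: in_morrey_def)
  have int: "set_integrable lebesgue ?B (\<lambda>v. \<bar>f v\<bar> powr p)"
    using f R unfolding in_morrey_def by blast
  let ?I = "LINT v:?B|lebesgue. \<bar>f v\<bar> powr p"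
  have I0: "0 \<le> ?I"
    unfolding set_lebesgue_integral_def by (intro Bochner_Integration.integral_nonneg) auto
  have le: "b powr (- \<kappa>) * ?I \<le> ?M"
    unfolding mb[symmetric] morrey_vals_def
    by (rule cSup_upper[OF _ bdd[unfolded morrey_vals_def]]) (use R in blast)
  \<comment> \<open>Nonnegativity of the supremum is read off from one of its members.\<close>
  then have M: "0 \<le> ?M" using I0 by (meson mult_nonneg_nonneg order_trans powr_ge_zero)
  have I: "?I \<le> ?M * b powr \<kappa>"
    using le b by (simp add: powr_minus_divide field_simps)
  have "(\<integral>\<^sup>+v. ennreal (\<bar>g v\<bar> powr p) * indicator ?B v \<partial>lborel) = (\<integral>\<^sup>+v. ennreal (indicator ?B v *\<^sub>R \<bar>f v\<bar> powr p) \<partial>lborel)"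
    by (rule nn_integral_cong_AE) (use fg in \<open>eventually_elim, auto simp: indicator_def\<close>)
  also have "\<dots> = ennreal ?I"
    unfolding set_lebesgue_integral_def
    by (subst nn_integral_completion[symmetric], subst nn_integral_eq_integral)
      (use int in \<open>auto simp: set_integrable_def\<close>)
  also have "\<dots> \<le> ennreal (?M * b powr \<kappa>)"
    by (rule ennreal_leI[OF I])
  finally have "(\<integral>\<^sup>+v. ennreal \<bar>g v\<bar> * indicator ?B v \<partial>lborel)
      \<le> ennreal (2 * (?M * b powr \<kappa>) powr (1 / p) * b powr (1 - 1 / p))"
    using M p b emeasure_heis_ball[OF R, of u] by (intro nn_integral_le_powr_integral) (auto simp: b_def)
  also have "2 * (?M * b powr \<kappa>) powr (1 / p) * b powr (1 - 1 / p) = 2 * ?M powr (1 / p) * (b powr (\<kappa> / p) * b powr (1 - 1 / p))"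
    using M by (simp add: powr_mult powr_powr)
  also have "b powr (\<kappa> / p) * b powr (1 - 1 / p) = b powr (1 - (1 - \<kappa>) / p)"
    by (simp add: diff_divide_distrib algebra_simps flip: powr_add)
  also have "\<dots> = ball_volume TYPE('n) powr (1 - (1 - \<kappa>) / p) * R powr (hdim TYPE('n) * (1 - (1 - \<kappa>) / p))"
    using R ball_volume_pos[where 'n='n] by (simp add: b_def powr_mult powr_powr)
  finally show ?thesis by (simp add: morrey_norm_def ac_simps)
qed

section \<open>Boundedness of the fractional integral from Morrey to Campanato spaces\<close>

theorem theorem4p6:
  fixes h :: "real \<Rightarrow> 'n::finite heis \<Rightarrow> real"
    and \<alpha> p \<kappa> \<beta> \<delta> :: real
  assumes "heat_kernel h"
    and "0 < \<alpha>" and "\<alpha> < hdim TYPE('n)"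
    and "1 \<le> p" and "p < hdim TYPE('n) / \<alpha>"
    and "1 - \<alpha> * p / hdim TYPE('n) \<le> \<kappa>" and "\<kappa> < 1"
    and "\<beta> / hdim TYPE('n) = \<alpha> / hdim TYPE('n) - (1 - \<kappa>) / p"
    and "0 < \<delta>" and "\<delta> \<le> 1" and "kernel_regular h \<alpha> \<delta>"
    and "\<beta> < \<delta>"
  shows "\<exists>C>0. \<forall>f :: 'n heis \<Rightarrow> real.
           in_morrey p \<kappa> f \<and>
           (AE u in lebesgue. integrable lebesgue (\<lambda>v. frac_kernel2 h \<alpha> u v * f v)) \<longrightarrow>
           in_campanato \<beta> (frac_int h \<alpha> f) \<and>
           campanato_norm \<beta> (frac_int h \<alpha> f) \<le> C * morrey_norm p \<kappa> f"
proof -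
  let ?Q = "hdim TYPE('n)" and ?V = "ball_volume TYPE('n)"
  have Q: "0 < ?Q" by (simp add: hdim_def add_pos_pos)
  define \<theta> where "\<theta> = ?Q * (1 - (1 - \<kappa>) / p)"
  \<comment> \<open>With a = Q - \<alpha> this reads \<theta> - a = \<beta>, so \<theta> < a +
    \<delta> is exactly \<beta> < \<delta>.\<close>
  have \<theta>: "\<theta> = ?Q - \<alpha> + \<beta>"
    using assms(8) Q by (simp add: \<theta>_def field_simps)
  obtain C where "0 < C" and C: "\<And>u v w :: 'n heis. heis_norm (heis_mult (heis_inv v) u) \<le> heis_norm (heis_mult (heis_inv w) u) / 2 \<Longrightarrow>
     \<bar>frac_kernel2 h \<alpha> u w - frac_kernel2 h \<alpha> v w\<bar>
       \<le> C * heis_norm (heis_mult (heis_inv v) u) powr \<delta> / heis_norm (heis_mult (heis_inv w) u) powr (?Q - \<alpha> + \<delta>)"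
    using assms(11) unfolding kernel_regular_def by blast
  interpret regular_kernel "frac_kernel h \<alpha>" C "?Q - \<alpha>" \<delta>
    by standard (use assms \<open>0 < C\<close> C[where w = 0] in \<open>auto simp: frac_kernel2_def\<close>)
  obtain E where E: "0 < E" and osc: "\<And>g G u0 r. g \<in> borel_measurable borel \<Longrightarrow> 0 \<le> G \<Longrightarrow> 0 < r \<Longrightarrow>
      (\<And>u R. 0 < R \<Longrightarrow> (\<integral>\<^sup>+v. ennreal \<bar>g v\<bar> * indicator (heis_ball u R) v \<partial>lborel) \<le> ennreal (G * R powr \<theta>)) \<Longrightarrow>
      AE u in lborel. integrable lborel (\<lambda>v. frac_kernel h \<alpha> (heis_mult (heis_inv v) u) * g v) \<Longrightarrow>
      \<exists>m. (\<integral>\<^sup>+u. ennreal \<bar>(\<integral>v. frac_kernel h \<alpha> (heis_mult (heis_inv v) u) * g v \<partial>lborel) - m\<bar> * indicator (heis_ball u0 r) u \<partial>lborel)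
        \<le> ennreal (E * G * r powr (?Q + \<theta> - (?Q - \<alpha>)))"
    by (rule potential_oscillation[of \<theta>]) (use assms \<theta> in auto)
  \<comment> \<open>The factors are the oscillation constant with the 2 from
    \<open>campanato_of_oscillation\<close>, the growth constant from \<open>morrey_growth\<close>,
    and the normalisation by the volume of the ball.\<close>
  define c where "c = 2 * E * (2 * ?V powr (1 - (1 - \<kappa>) / p)) * ?V powr (- 1 - \<beta> / ?Q)"
  show ?thesis
  proof (intro exI[of _ c] conjI allI impI; (elim conjE)?)
    show "0 < c" using E ball_volume_pos[where 'n='n] by (simp add: c_def)
    fix f :: "'n heis \<Rightarrow> real"
    assume f: "in_morrey p \<kappa> f" and int: "AE u in lebesgue. integrable lebesgue (\<lambda>v. frac_kernel2 h \<alpha> u v * f v)"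
    have f_meas [measurable]: "f \<in> borel_measurable lebesgue"
      using f by (simp add: in_morrey_def)
    obtain g where g [measurable]: "g \<in> borel_measurable borel" and fg: "AE v in lborel. f v = g v"
      using completion_ex_borel_measurable_real[OF f_meas] by auto
    have fg': "AE v in lebesgue. frac_kernel2 h \<alpha> u v * f v = frac_kernel2 h \<alpha> u v * g v" for u
      using AE_completion[OF fg] by eventually_elim simp
    have k_meas: "(\<lambda>v. frac_kernel2 h \<alpha> u v) \<in> borel_measurable borel" for u
      unfolding frac_kernel2_def by measurable
    have kg: "(\<lambda>v. frac_kernel2 h \<alpha> u v * g v) \<in> borel_measurable lborel" for u
      using k_meas by simp
    have kf: "(\<lambda>v. frac_kernel2 h \<alpha> u v * f v) \<in> borel_measurable lebesgue" for u
      using k_meas[of u] by (intro borel_measurable_times) (auto simp: measurable_completion)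
    \<comment> \<open>The identity holds at every u, not only almost everywhere: changing f on a
      null set preserves integrability and the integral, and where integrability fails both
      integrals are 0 by convention.\<close>
    have F_eq: "frac_int h \<alpha> f = (\<lambda>u. \<integral>v. frac_kernel h \<alpha> (heis_mult (heis_inv v) u) * g v \<partial>lborel)"
    proof
      fix u
      have "frac_int h \<alpha> f u = (\<integral>v. frac_kernel2 h \<alpha> u v * g v \<partial>lebesgue)"
        unfolding frac_int_def
        by (intro integral_cong_AE kf measurable_completion kg fg')
      also have "\<dots> = (\<integral>v. frac_kernel2 h \<alpha> u v * g v \<partial>lborel)"
        by (rule integral_completion[OF kg])
      finally show "frac_int h \<alpha> f u = (\<integral>v. frac_kernel h \<alpha> (heis_mult (heis_inv v) u) * g v \<partial>lborel)"
        by (simp add: frac_kernel2_def)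
    qed
    have "integrable lebesgue (\<lambda>v. frac_kernel2 h \<alpha> u v * f v) \<longleftrightarrow> integrable lborel (\<lambda>v. frac_kernel2 h \<alpha> u v * g v)" for u
      using integrable_cong_AE[OF kf measurable_completion[OF kg] fg'] integrable_completion[OF kg] by simp
    then have int': "AE u in lborel. integrable lborel (\<lambda>v. frac_kernel h \<alpha> (heis_mult (heis_inv v) u) * g v)"
      using int by (simp add: AE_completion_iff frac_kernel2_def)
    define G where "G = 2 * ?V powr (1 - (1 - \<kappa>) / p) * morrey_norm p \<kappa> f"
    have G: "0 \<le> G" by (simp add: G_def morrey_norm_def)
    have F_meas: "frac_int h \<alpha> f \<in> borel_measurable borel"
      unfolding F_eq by (rule lborel.borel_measurable_lebesgue_integral) measurable
    have F_osc: "\<exists>m. (\<integral>\<^sup>+v. ennreal \<bar>frac_int h \<alpha> f v - m\<bar> * indicator (heis_ball u r) v \<partial>lborel)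
        \<le> ennreal (E * G * r powr (?Q + \<beta>))" if r: "0 < r" for u r
    proof -
      have "?Q + \<theta> - (?Q - \<alpha>) = ?Q + \<beta>" by (simp add: \<theta>)
      then show ?thesis
        unfolding F_eq
        using osc[OF g G r _ int', of u] morrey_growth[OF f assms(4) g fg]
        by (simp add: G_def \<theta>_def)
    qed
    note camp = campanato_of_oscillation[OF F_meas _ F_osc]
    show "in_campanato \<beta> (frac_int h \<alpha> f)"
      using E G by (intro camp) simp_all
    show "campanato_norm \<beta> (frac_int h \<alpha> f) \<le> c * morrey_norm p \<kappa> f"
      using camp(2) E G by (simp add: c_def G_def ac_simps)
  qed
qed

end
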